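(* Let $f(z)=e^z+a$ be an exponential map with accessible singular value $a$ (and an associated partition into itinerary strips) such that $a$ has a unique itinerary (kneading sequence) $u_0u_1u_2\dots$. If this kneading sequence is not periodic, then $I(f)$ is connected.
   Context: $I(f)=\{z: f^n(z)\to\infty\}$; $J(f)$ is the Julia set. The singular value $a$ is accessible if $a\in J(f)$ and there is an injective curve $\gamma:[0,\infty)\to J(f)$ with $\gamma(0)=a$, $\gamma(t)\in I(f)$ for $t>0$, and $\operatorname{Re}\gamma(t)\to\infty$. Every component of $f^{-1}(\gamma)$ is a curve to $\infty$ in both directions, and $\mathbb{C}\setminus f^{-1}(\gamma)$ consists of strips $S_k$ ($k\in\mathbb{Z}$) with $S_k=S_0+2\pi i k$. An itinerary of $z$ is an integer sequence $u_0u_1\dots$ with $f^j(z)\in\overline{S_{u_j}}$ for all $j\ge0$; it is unique if the orbit of $z$ never meets $f^{-1}(\gamma)$. The itinerary of $a$ is the kneading sequence. A sequence is periodic if $u_{j+p}=u_j$ for some $p\ge1$ and all $j\ge0$. *)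

theory Defs
  imports "HOL-Analysis.Analysis"
begin

definition expmap :: "complex \<Rightarrow> complex \<Rightarrow> complex" where
  "expmap a z = exp z + a"

text \<open>Normality of a family (F n) on an open set U: every sequence of members has a
  subsequence converging locally uniformly (in the spherical sense), i.e. either
  uniformly on compacta to a (finite) limit function, or uniformly on compacta to infinity.\<close>
definition normal_family_on :: "(nat \<Rightarrow> complex \<Rightarrow> complex) \<Rightarrow> complex set \<Rightarrow> bool" where
  "normal_family_on F U \<longleftrightarrow>
     (\<forall>r::nat \<Rightarrow> nat. \<exists>s::nat \<Rightarrow> nat. strict_mono s \<and>
        ((\<exists>g. \<forall>K. compact K \<and> K \<subseteq> U \<longrightarrow> uniform_limit K (\<lambda>k. F (r (s k))) g sequentially)
         \<or> (\<forall>K. compact K \<and> K \<subseteq> U \<longrightarrow>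
              (\<forall>M. eventually (\<lambda>k. \<forall>z\<in>K. M < norm (F (r (s k)) z)) sequentially))))"

definition fatou_set :: "(complex \<Rightarrow> complex) \<Rightarrow> complex set" where
  "fatou_set f = {z. \<exists>U. open U \<and> z \<in> U \<and> normal_family_on (\<lambda>n. f ^^ n) U}"

definition julia_set :: "(complex \<Rightarrow> complex) \<Rightarrow> complex set" where
  "julia_set f = - fatou_set f"

definition escaping_set :: "(complex \<Rightarrow> complex) \<Rightarrow> complex set" where
  "escaping_set f = {z. filterlim (\<lambda>n. (f ^^ n) z) at_infinity sequentially}"

definition access_curve :: "(complex \<Rightarrow> complex) \<Rightarrow> complex \<Rightarrow> (real \<Rightarrow> complex) \<Rightarrow> bool" where
  "access_curve f a \<gamma> \<longleftrightarrow>
     a \<in> julia_set f \<and> continuous_on {0..} \<gamma> \<and> inj_on \<gamma> {0..} \<and>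
     \<gamma> ` {0..} \<subseteq> julia_set f \<and> \<gamma> 0 = a \<and>
     (\<forall>t>0. \<gamma> t \<in> escaping_set f) \<and>
     filterlim (\<lambda>t. Re (\<gamma> t)) at_top at_top"

definition strip :: "complex set \<Rightarrow> int \<Rightarrow> complex set" where
  "strip S0 k = (\<lambda>z. z + 2 * of_real pi * \<i> * of_int k) ` S0"

definition is_itinerary :: "(complex \<Rightarrow> complex) \<Rightarrow> complex set \<Rightarrow> complex \<Rightarrow> (nat \<Rightarrow> int) \<Rightarrow> bool" where
  "is_itinerary f S0 z u \<longleftrightarrow> (\<forall>j. (f ^^ j) z \<in> closure (strip S0 (u j)))"

definition periodic_seq :: "(nat \<Rightarrow> int) \<Rightarrow> bool" where
  "periodic_seq u \<longleftrightarrow> (\<exists>p\<ge>1. \<forall>j. u (j + p) = u j)"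

end

theory Submission
  imports Defs "HOL-Complex_Analysis.Complex_Analysis"
begin

text \<open>
  Let \<open>E\<close> be the escaping set minus the orbit of \<open>a\<close>. The complement of \<open>E\<close> is forward
  invariant, \<open>E\<close> contains the ray and its lifts under \<open>f\<close>, and by Bloch's theorem the iterated
  preimages of the ray are dense in the escaping set. So it suffices that no separation of \<open>E\<close>
  splits these preimages, and since separations can be pushed forward through a strip, that none
  splits the ray and its lifts.

  If two lifts are separated, then by unicoherence of the plane they are separated by a continuum
  \<open>P\<close> off \<open>E\<close> that runs through one strip from left to right, and \<open>f ` P \<union> {a}\<close> is a continuum from
  \<open>a\<close> to \<open>\<infinity>\<close> all of whose points have itinerary \<open>u\<close>. As \<open>u\<close> is not periodic, none of its iterated
  images is unbounded to the left. As \<open>u\<close> grows at most like an orbit of \<open>f\<close>, the far part of the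
  continuum can then never cross the imaginary axis, hence escapes, which is impossible off \<open>E\<close>.
  If instead the ray is separated from all its lifts by \<open>P\<close>, then each iterated image of \<open>P\<close>
  surrounds some iterated image of the ray inside one strip, and the same growth argument applies.
\<close>

section \<open>Logarithms and plane topology\<close>

text \<open>Removing the orbit of \<open>a\<close> keeps \<open>a\<close> itself off
  \<open>E\<close> even when \<open>a\<close> escapes, so that a continuum off \<open>E\<close> may
  run into \<open>a\<close>; uniqueness of the itinerary keeps the ray and its lifts off that orbit,
  hence inside \<open>E\<close>. A connected set off \<open>E\<close> crosses no lift, so each of
  its iterated images stays in one strip, and this strip can be read off from any orbit point of
  \<open>a\<close> in the closure of the set. Periodicity enters here: far to the left
  \<open>f\<close> is close to \<open>a\<close>, so an iterated image unbounded to the left puts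
  \<open>a\<close> into the closure of the next one, whose strips are a shift of \<open>u\<close>,
  and the two readings make \<open>u\<close> periodic. Once the images are bounded to the left, the
  obstacle is that a large modulus might be spent on the imaginary part. Up to a constant, that part
  is at most the modulus of a comparison orbit, majorised by
  \<open>g (Suc n) = exp (g n) + norm a\<close>. A real part ahead of \<open>g n\<close> by a
  constant makes the next modulus ahead by a factor, so the lead is never lost.\<close>

definition vshift :: "int \<Rightarrow> complex" where
  "vshift k = 2 * of_real pi * \<i> * of_int k"

lemma Re_vshift [simp]: "Re (vshift k) = 0"
  and Im_vshift [simp]: "Im (vshift k) = 2 * pi * of_int k"
  by (simp_all add: vshift_def)

lemma vshift_diff: "vshift (j - k) = vshift j - vshift k"
  and vshift_0 [simp]: "vshift 0 = 0"
  by (simp_all add: vshift_def algebra_simps)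

lemma vshift_inject [simp]: "vshift j = vshift k \<longleftrightarrow> j = k"
  by (simp add: vshift_def)

lemma exp_vshift [simp]: "exp (z + vshift k) = exp z"
  unfolding exp_eq by (rule exI[of _ k]) (simp add: vshift_def)

lemma exp_eq_vshift: "exp w = exp z \<longleftrightarrow> (\<exists>k. w = z + vshift k)"
  by (simp add: exp_eq vshift_def algebra_simps)

lemma strip_vshift: "strip S k = (\<lambda>z. z + vshift k) ` S"
  by (simp add: strip_def vshift_def)

lemma expmap_vshift [simp]: "expmap a (z + vshift k) = expmap a z"
  by (simp add: expmap_def)

lemma expmap_eq_iff: "expmap a w = expmap a z \<longleftrightarrow> (\<exists>k. w = z + vshift k)"
  by (simp add: expmap_def exp_eq_vshift)

lemma expmap_neq [simp]: "expmap a z \<noteq> a"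
  by (simp add: expmap_def)

lemma norm_expmap_diff: "norm (expmap a z - a) = exp (Re z)"
  by (simp add: expmap_def)

lemma continuous_on_expmap [continuous_intros]:
  "continuous_on S g \<Longrightarrow> continuous_on S (\<lambda>z. expmap a (g z))"
  unfolding expmap_def by (intro continuous_intros)

lemma holomorphic_expmap: "expmap a holomorphic_on S"
  unfolding expmap_def by (intro holomorphic_intros)

lemma continuous_on_funpow:
  fixes f :: "'a::topological_space \<Rightarrow> 'a"
  assumes "continuous_on UNIV f"
  shows "continuous_on UNIV (f ^^ n)"
proof (induction n)
  case (Suc n)
  have "continuous_on UNIV (f \<circ> (f ^^ n))"
    by (rule continuous_on_compose[OF Suc]) (rule continuous_on_subset[OF assms subset_UNIV])
  then show ?case by simp
qed (simp add: continuous_on_id)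

lemma continuous_on_expmap_funpow: "continuous_on S (expmap a ^^ n)"
  using continuous_on_funpow[of "expmap a"] continuous_on_expmap[OF continuous_on_id]
  by (metis continuous_on_subset subset_UNIV)

lemma open_expmap_image:
  assumes "open U"
  shows "open (expmap a ` U)"
proof (rule open_mapping_thm[OF holomorphic_expmap open_UNIV connected_UNIV assms subset_UNIV])
  show "\<not> expmap a constant_on UNIV"
  proof
    assume "expmap a constant_on UNIV"
    then obtain y where "\<And>z. expmap a z = y" by (auto simp: constant_on_def)
    then have "expmap a 0 = expmap a (of_real (ln 2))" by simp
    then have "exp (ln 2 :: real) = 1"
      by (simp add: expmap_def exp_of_real flip: of_real_eq_1_iff)
    then show False by simp
  qed
qed

lemma funpow_image_Suc: "(f ^^ Suc n) ` A = f ` (f ^^ n) ` A"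
  by (simp add: image_comp)

lemma open_expmap_funpow_image: "open U \<Longrightarrow> open ((expmap a ^^ n) ` U)"
proof (induction n)
  case (Suc n)
  then show ?case using open_expmap_image funpow_image_Suc by metis
qed auto

text \<open>The complement of a component \<open>A\<close> of \<open>- Z\<close> is connected and
  contains the unbounded set \<open>Z\<close>, so \<open>A\<close> is simply connected; as
  \<open>a\<close> lies in \<open>Z\<close>, the function \<open>w - a\<close> has no zero
  there.\<close>

lemma log_off_continuum:
  fixes a :: complex
  assumes "closed Z" "connected Z" "\<not> bounded Z" "a \<in> Z" "A \<in> components (- Z)"
  obtains l where "continuous_on A l" "\<And>w. w \<in> A \<Longrightarrow> exp (l w) = w - a"
proof -
  have A: "open A" "connected A" "A \<subseteq> - Z"
    using open_components[OF _ assms(5)] in_components_connected[OF assms(5)]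
      in_components_subset[OF assms(5)] assms(1) by (simp_all add: open_Compl)
  have "connected (- A)"
    using component_complement_connected assms by blast
  moreover have "- A \<noteq> {}" using A assms(4) by auto
  ultimately have "components (- A) = {- A}"
    by (simp add: components_eq_sing_iff)
  moreover have "\<not> bounded (- A)"
    using assms(3) A(3) bounded_subset[of "- A" Z] by auto
  ultimately have sc: "simply_connected A"
    using simply_connected_eq_unbounded_complement_components[OF A(1)] A(2) by simp
  obtain l where "continuous_on A l" "\<And>w. w \<in> A \<Longrightarrow> w - a = exp (l w)"
  proof (rule continuous_logarithm_on_simply_connected[of A "\<lambda>w. w - a"])
    show "continuous_on A (\<lambda>w. w - a)" by (intro continuous_intros)
    show "locally path_connected A" using A(1) open_imp_locally_path_connected by blast
    show "w - a \<noteq> 0" if "w \<in> A" for w using that A(3) assms(4) by auto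
  qed (auto intro: sc)
  then show thesis using that by metis
qed

text \<open>Two logarithms of \<open>expmap a z - a\<close> differ by some \<open>vshift k\<close>;
  distinct shifts are at least \<open>2 * pi\<close> apart, so the difference is constant on a
  connected set.\<close>

lemma log_expmap_translate:
  assumes "continuous_on A l" "\<And>w. w \<in> A \<Longrightarrow> exp (l w) = w - a"
    and "connected J" "expmap a ` J \<subseteq> A"
  obtains k where "\<And>z. z \<in> J \<Longrightarrow> z = l (expmap a z) + vshift k"
proof -
  define h where "h z = z - l (expmap a z)" for z
  have h: "\<exists>k. h z = vshift k" if "z \<in> J" for z
  proof -
    have "exp z = exp (l (expmap a z))"
      using assms(2,4) that by (force simp: expmap_def)
    then obtain k where "z = l (expmap a z) + vshift k" unfolding exp_eq_vshift by blast
    then have "h z = vshift k" unfolding h_def by (metis add_diff_cancel_left')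
    then show ?thesis ..
  qed
  have "h constant_on J"
  proof (rule continuous_discrete_range_constant[OF \<open>connected J\<close>])
    show "continuous_on J h"
      unfolding h_def using assms(4)
      by (intro continuous_intros continuous_on_compose2[OF assms(1)]) auto
    show "\<exists>e>0. \<forall>y. y \<in> J \<and> h y \<noteq> h x \<longrightarrow> e \<le> norm (h y - h x)" if x: "x \<in> J" for x
    proof (intro exI[of _ "2 * pi"] conjI allI impI)
      fix y assume y: "y \<in> J \<and> h y \<noteq> h x"
      then obtain j k where jk: "h y = vshift j" "h x = vshift k" using h x by blast
      then have "j \<noteq> k" using y by auto
      then have "1 \<le> \<bar>real_of_int (j - k)\<bar>" by linarith
      then have "2 * pi \<le> \<bar>Im (h y - h x)\<bar>"
        using jk by (simp add: abs_mult flip: right_diff_distrib)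
      then show "2 * pi \<le> norm (h y - h x)"
        using abs_Im_le_cmod order_trans by blast
    qed auto
  qed
  then obtain y where y: "\<And>z. z \<in> J \<Longrightarrow> h z = y" by (auto simp: constant_on_def)
  obtain k where "\<And>z. z \<in> J \<Longrightarrow> h z = vshift k"
  proof (cases "J = {}")
    case False
    then show thesis using y h that by metis
  qed (use that in auto)
  then show thesis using that[of k] by (simp add: h_def algebra_simps)
qed

text \<open>Otherwise the Borsuk map of the boundary of a bounded neighbourhood of \<open>T\<close> would be inessential.\<close>
lemma no_log_around_compact:
  fixes a :: complex
  assumes "compact T" "closed H" "T \<inter> H = {}" "a \<in> T"
    and l: "continuous_on (- (T \<union> H)) l" "\<And>w. w \<notin> T \<union> H \<Longrightarrow> exp (l w) = w - a"
  shows False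
proof -
  obtain d where d: "d > 0" "\<And>x y. x \<in> T \<Longrightarrow> y \<in> H \<Longrightarrow> d \<le> dist x y"
    using separate_compact_closed[OF assms(1-3)] by auto
  \<comment> \<open>With half of the distance \<open>d\<close>, the closure of the neighbourhood
    still misses \<open>H\<close>, and its frontier lies where \<open>l\<close> is defined.\<close>
  define W where "W = (\<Union>x\<in>T. ball x (d/2))"
  have opW: "open W" and TW: "T \<subseteq> W" using d by (auto simp: W_def)
  have "bounded W"
  proof -
    obtain B where "\<And>x. x \<in> T \<Longrightarrow> norm x \<le> B"
      using assms(1) compact_imp_bounded bounded_iff by metis
    then have "norm z \<le> B + d/2" if "z \<in> W" for z
      using that unfolding W_def
      by (smt (verit) UN_E dist_norm mem_ball norm_minus_commute norm_triangle_sub)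
    then show ?thesis unfolding bounded_iff by blast
  qed
  then have bdc: "bounded (closure W)" by blast
  have clW: "\<exists>x\<in>T. dist x z \<le> d/2" if "z \<in> closure W" for z
  proof -
    have "closed (\<Union>x\<in>T. \<Union>y\<in>cball 0 (d/2). {x + y})"
      by (rule compact_imp_closed) (rule compact_sums'[OF assms(1) compact_cball])
    moreover have "W \<subseteq> (\<Union>x\<in>T. \<Union>y\<in>cball 0 (d/2). {x + y})"
    proof
      fix z assume "z \<in> W"
      then obtain x where "x \<in> T" "dist x z < d/2" by (auto simp: W_def)
      then show "z \<in> (\<Union>x\<in>T. \<Union>y\<in>cball 0 (d/2). {x + y})"
        by (intro UN_I[of x] UN_I[of "z - x"]) (auto simp: dist_norm norm_minus_commute)
    qed
    ultimately have "z \<in> (\<Union>x\<in>T. \<Union>y\<in>cball 0 (d/2). {x + y})"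
      using that closure_minimal by blast
    then obtain x y where "x \<in> T" "norm y \<le> d/2" "z = x + y" by auto
    then show ?thesis by (intro bexI[of _ x]) (auto simp: dist_norm)
  qed
  have fr: "frontier W \<subseteq> - (T \<union> H)"
  proof
    fix z assume z: "z \<in> frontier W"
    then have "z \<notin> T" using TW opW by (auto simp: frontier_def interior_open)
    moreover have "z \<notin> H"
    proof
      assume "z \<in> H"
      moreover obtain x where "x \<in> T" "dist x z \<le> d/2" using clW z by (auto simp: frontier_def)
      ultimately show False using d by force
    qed
    ultimately show "z \<in> - (T \<union> H)" by auto
  qed
  have cF: "compact (frontier W)" using \<open>bounded W\<close> compact_frontier_bounded by blast
  have aF: "a \<notin> frontier W" using fr assms(4) by auto
  have "connected_component_set (- frontier W) a \<subseteq> W"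
  proof (rule ccontr)
    let ?C = "connected_component_set (- frontier W) a"
    assume "\<not> ?C \<subseteq> W"
    moreover have "a \<in> ?C \<inter> W" using aF TW assms(4) by auto
    ultimately have "?C \<inter> frontier W \<noteq> {}"
      using connected_Int_frontier[of ?C W] by blast
    then show False using connected_component_subset by fastforce
  qed
  then have "bounded (connected_component_set (- frontier W) a)"
    using \<open>bounded W\<close> bounded_subset by blast
  \<comment> \<open>On the frontier the Borsuk map at \<open>a\<close> equals
    \<open>exp (\<i> * of_real (Im (l x)))\<close>, hence is inessential, although \<open>a\<close>
    lies in a bounded component of the complement.\<close>
  moreover have "\<exists>c. homotopic_with_canon (\<lambda>x. True) (frontier W) (sphere 0 1)
                               (\<lambda>x. inverse(norm(x - a)) *\<^sub>R (x - a)) (\<lambda>x. c)"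
    unfolding inessential_eq_continuous_logarithm_circle
  proof (intro exI conjI ballI)
    show "continuous_on (frontier W) (\<lambda>w. Im (l w))"
      by (intro continuous_intros continuous_on_subset[OF l(1) fr])
    fix x assume "x \<in> frontier W"
    then have e: "x - a = exp (l x)" using l(2) fr by force
    show "inverse (norm (x - a)) *\<^sub>R (x - a) = exp (\<i> * of_real (Im (l x)))"
      unfolding e by (subst (2) exp_eq_polar) (simp add: cis_conv_exp scaleR_conv_of_real)
  qed
  ultimately show False
    using Borsuk_map_essential_bounded_component[OF cF aF] by blast
qed

text \<open>Truncating the real part of \<open>g\<close> gives a path crossing a rectangle from left to right.\<close>
lemma crossing:
  fixes g :: "real \<Rightarrow> complex"
  assumes contg: "continuous_on {0<..} g"
    and ends: "\<And>A. \<exists>s t. 0 < s \<and> s < t \<and> Re (g s) \<le> - A \<and> A \<le> Re (g t)"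
    and bdd: "\<And>t. t > 0 \<Longrightarrow> - M \<le> Re (g t) \<Longrightarrow> \<bar>Im (g t)\<bar> \<le> C"
    and p: "path p" "- M \<le> Re (pathstart p)" "- M \<le> Re (pathfinish p)"
      "Im (pathstart p) < - C" "C < Im (pathfinish p)"
  shows "\<exists>t>0. g t \<in> path_image p"
proof -
  obtain B where B: "\<And>z. z \<in> path_image p \<Longrightarrow> norm z \<le> B"
    using bounded_path_image[OF p(1)] bounded_iff by metis
  define A where "A = \<bar>B\<bar> + \<bar>M\<bar> + 1"
  have pA: "\<bar>Re z\<bar> < A" "\<bar>Im z\<bar> < A" if "z \<in> path_image p" for z
    using B[OF that] abs_Re_le_cmod[of z] abs_Im_le_cmod[of z] unfolding A_def by linarith+
  obtain s t where st: "0 < s" "s < t" "Re (g s) \<le> - A" "A \<le> Re (g t)"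
    using ends by blast
  have cst: "continuous_on {s..t} g" by (rule continuous_on_subset[OF contg]) (use st in auto)
  then have "compact (g ` {s..t})" by (intro compact_continuous_image) auto
  then obtain D where D: "\<And>r. r \<in> {s..t} \<Longrightarrow> norm (g r) \<le> D"
    using compact_imp_bounded bounded_iff by (metis image_eqI)
  define Y where "Y = \<bar>D\<bar> + \<bar>C\<bar> + A + 1"
  have A0: "A > 0" and Y0: "Y > 0" and AY: "A < Y" and DY: "D < Y" and CY: "\<bar>C\<bar> < Y"
    by (auto simp: A_def Y_def)
  define V :: "real \<Rightarrow> real \<Rightarrow> real^2" where "V x y = vector [x, y]" for x y
  have V[simp]: "V x y $ 1 = x" "V x y $ 2 = y" for x y by (simp_all add: V_def)
  have Vcont: "continuous_on S (\<lambda>x. V (h x) (k x))"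
    if "continuous_on S h" "continuous_on S k" for S :: "real set" and h k
  proof -
    have "V (h x) (k x) = h x *\<^sub>R V 1 0 + k x *\<^sub>R V 0 1" for x
      by (simp add: vec_eq_iff forall_2)
    then show ?thesis using that by (auto intro!: continuous_intros)
  qed
  define cl where "cl x = max (- A) (min A x)" for x
  define gg where "gg r = (let w = g (s + r * (t - s)) in V (cl (Re w)) (Im w))" for r
  have pgg: "path gg"
    unfolding path_def gg_def Let_def cl_def
  proof (rule Vcont)
    have *: "continuous_on {0..1} (\<lambda>r. g (s + r * (t - s)))"
    proof (rule continuous_on_compose2[OF cst])
      show "(\<lambda>r. s + r * (t - s)) ` {0..1} \<subseteq> {s..t}"
        using st by (auto simp: mult_left_le_one_le) (smt (verit) mult_left_le_one_le)
    qed (intro continuous_intros)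
    show "continuous_on {0..1} (\<lambda>r. max (- A) (min A (Re (g (s + r * (t - s))))))"
      by (intro continuous_intros *)
    show "continuous_on {0..1} (\<lambda>r. Im (g (s + r * (t - s))))"
      by (intro continuous_intros *)
  qed
  \<comment> \<open>Vertical segments prolong \<open>p\<close> to the lower and upper sides of the
    rectangle. On them the real part is at least \<open>- M\<close> and the imaginary part is below
    \<open>- C\<close> or above \<open>C\<close>, so \<open>g\<close> misses them by
    \<open>bdd\<close>.\<close>
  define q where "q = linepath (Complex (Re (pathstart p)) (- Y)) (pathstart p) +++ p
      +++ linepath (pathfinish p) (Complex (Re (pathfinish p)) Y)"
  have pq: "path q" unfolding q_def using p(1) by auto
  have q1: "pathstart q = Complex (Re (pathstart p)) (- Y)"
    and q2: "pathfinish q = Complex (Re (pathfinish p)) Y" by (auto simp: q_def)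
  have pse: "pathstart p \<in> path_image p" "pathfinish p \<in> path_image p" by auto
  have seg1: "- M \<le> Re z \<and> \<bar>Re z\<bar> < A \<and> Im z < - C \<and> \<bar>Im z\<bar> \<le> Y"
    if z: "z \<in> closed_segment (Complex (Re (pathstart p)) (- Y)) (pathstart p)" for z
  proof -
    have "z \<in> closed_segment (Complex (Re (pathstart p)) (- Y)) (Complex (Re (pathstart p)) (Im (pathstart p)))"
      using z by simp
    then obtain u where u: "0 \<le> u" "u \<le> 1"
      "z = (1-u) *\<^sub>R Complex (Re (pathstart p)) (- Y) + u *\<^sub>R Complex (Re (pathstart p)) (Im (pathstart p))"
      unfolding closed_segment_def by blast
    have r: "Re z = Re (pathstart p)" by (simp add: u(3) algebra_simps)
    have "Im z \<in> closed_segment (-Y) (Im (pathstart p))"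
      unfolding closed_segment_def using u by auto
    moreover have "- Y < Im (pathstart p)" using pA(2)[OF pse(1)] AY by auto
    ultimately have "- Y \<le> Im z" "Im z \<le> Im (pathstart p)"
      by (auto simp: closed_segment_eq_real_ivl)
    then show ?thesis using r p pA[OF pse(1)] AY by auto
  qed
  have seg2: "- M \<le> Re z \<and> \<bar>Re z\<bar> < A \<and> C < Im z \<and> \<bar>Im z\<bar> \<le> Y"
    if z: "z \<in> closed_segment (pathfinish p) (Complex (Re (pathfinish p)) Y)" for z
  proof -
    have "z \<in> closed_segment (Complex (Re (pathfinish p)) (Im (pathfinish p))) (Complex (Re (pathfinish p)) Y)"
      using z by simp
    then obtain u where u: "0 \<le> u" "u \<le> 1"
      "z = (1-u) *\<^sub>R Complex (Re (pathfinish p)) (Im (pathfinish p)) + u *\<^sub>R Complex (Re (pathfinish p)) Y"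
      unfolding closed_segment_def by blast
    have r: "Re z = Re (pathfinish p)" by (simp add: u(3) algebra_simps)
    have "Im z \<in> closed_segment (Im (pathfinish p)) Y"
      unfolding closed_segment_def using u by auto
    moreover have "Im (pathfinish p) < Y" using pA(2)[OF pse(2)] AY by auto
    ultimately have "Im z \<le> Y" "Im (pathfinish p) \<le> Im z"
      by (auto simp: closed_segment_eq_real_ivl)
    then show ?thesis using r p pA[OF pse(2)] AY by auto
  qed
  have qim: "path_image q \<subseteq> closed_segment (Complex (Re (pathstart p)) (- Y)) (pathstart p)
      \<union> path_image p \<union> closed_segment (pathfinish p) (Complex (Re (pathfinish p)) Y)"
    unfolding q_def by (auto simp: path_image_join)
  have qbd: "\<bar>Re z\<bar> < A \<and> \<bar>Im z\<bar> \<le> Y" if "z \<in> path_image q" for z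
    using qim that seg1 seg2 pA AY by (smt (verit, best) UnE subsetD)
  define qq where "qq r = V (Re (q r)) (Im (q r))" for r
  have pqq: "path qq" unfolding path_def qq_def
    using pq by (intro Vcont) (auto simp: path_def intro!: continuous_intros)
  have gr: "s + r * (t - s) \<in> {s..t}" if "r \<in> {0..1}" for r
    using that st by (auto simp: mult_left_le_one_le) (smt (verit) mult_left_le_one_le)
  obtain v where v: "v \<in> path_image gg" "v \<in> path_image qq"
  proof (rule fashoda[OF pgg pqq, of "V (-A) (-Y)" "V A Y"])
    show "path_image gg \<subseteq> cbox (V (- A) (- Y)) (V A Y)"
    proof
      fix v assume "v \<in> path_image gg"
      then obtain r where r: "r \<in> {0..1}" "v = gg r" by (auto simp: path_image_def)
      have "\<bar>Im (g (s + r * (t - s)))\<bar> \<le> D"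
        using D[OF gr[OF r(1)]] abs_Im_le_cmod order_trans by blast
      then show "v \<in> cbox (V (- A) (- Y)) (V A Y)"
        using DY A0 unfolding r(2) gg_def Let_def mem_box_cart forall_2 cl_def by auto
    qed
    show "path_image qq \<subseteq> cbox (V (- A) (- Y)) (V A Y)"
    proof
      fix v assume "v \<in> path_image qq"
      then obtain r where r: "r \<in> {0..1}" "v = qq r" by (auto simp: path_image_def)
      then have "\<bar>Re (q r)\<bar> < A \<and> \<bar>Im (q r)\<bar> \<le> Y" using qbd by (auto simp: path_image_def)
      then show "v \<in> cbox (V (- A) (- Y)) (V A Y)"
        unfolding r(2) qq_def mem_box_cart forall_2 by auto
    qed
    show "pathstart gg $ 1 = V (- A) (- Y) $ 1"
      using st A0 by (simp add: pathstart_def gg_def Let_def cl_def)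
    show "pathfinish gg $ 1 = V A Y $ 1"
      using st A0 by (simp add: pathfinish_def gg_def Let_def cl_def)
    show "pathstart qq $ 2 = V (- A) (- Y) $ 2"
      using q1 by (simp add: pathstart_def qq_def)
    show "pathfinish qq $ 2 = V A Y $ 2"
      using q2 by (simp add: pathfinish_def qq_def)
  qed
  then obtain r r' where rr: "r \<in> {0..1}" "v = gg r" "r' \<in> {0..1}" "v = qq r'"
    by (auto simp: path_image_def)
  define w where "w = g (s + r * (t - s))"
  have pos: "s + r * (t - s) > 0" using gr[OF rr(1)] st by auto
  have e: "cl (Re w) = Re (q r')" "Im w = Im (q r')"
    using rr unfolding gg_def qq_def Let_def w_def by (metis V)+
  have qr: "q r' \<in> path_image q" using rr by (auto simp: path_image_def)
  have "\<bar>cl (Re w)\<bar> < A" using qbd[OF qr] e by auto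
  then have "cl (Re w) = Re w" unfolding cl_def by linarith
  then have "w = q r'" using e by (simp add: complex_eq_iff)
  moreover have "w \<notin> closed_segment (Complex (Re (pathstart p)) (- Y)) (pathstart p)"
    using seg1[of w] bdd[OF pos] unfolding w_def by fastforce
  moreover have "w \<notin> closed_segment (pathfinish p) (Complex (Re (pathfinish p)) Y)"
    using seg2[of w] bdd[OF pos] unfolding w_def by fastforce
  ultimately have "w \<in> path_image p" using qr qim by auto
  then show ?thesis using pos unfolding w_def by blast
qed

text \<open>The closed set \<open>- (U \<union> V)\<close> separates \<open>p\<close> from
  \<open>z\<close>; by the pointwise form of unicoherence one of its components already
  does.\<close>

lemma separating_continuum:
  fixes U V :: "'a :: euclidean_space set"
  assumes "open U" "open V" "U \<inter> V = {}" "p \<in> U" "z \<in> V"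
  obtains P where "closed P" "connected P" "P \<inter> (U \<union> V) = {}" "\<not> connected_component (- P) p z"
proof -
  define X where "X = - (U \<union> V)"
  have X: "closed X" "- X = U \<union> V" using assms by (auto simp: X_def closed_Compl)
  have "\<not> connected_component (- X) p z"
  proof
    assume "connected_component (- X) p z"
    then obtain T where "connected T" "T \<subseteq> U \<union> V" "p \<in> T" "z \<in> T"
      unfolding connected_component_def X(2) by blast
    then show False using connectedD[of T U V] assms by blast
  qed
  then obtain P where P: "P \<in> components X" "\<not> connected_component (- P) p z"
    using separation_by_component_closed_pointwise[OF X(1)] by blast
  moreover have "closed P" "connected P" "P \<subseteq> X"
    using P(1) closed_components[OF X(1)] in_components_connected in_components_subset by blast+
  ultimately show thesis using that X(2) by blast
qed

section \<open>The ray and its lifts\<close>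

locale access_ray =
  fixes a :: complex and \<gamma> :: "real \<Rightarrow> complex"
  assumes continuous: "continuous_on {0..} \<gamma>"
    and injective: "inj_on \<gamma> {0..}"
    and start: "\<gamma> 0 = a"
    and escapes: "t > 0 \<Longrightarrow> \<gamma> t \<in> escaping_set (expmap a)"
    and Re_at_top: "filterlim (\<lambda>t. Re (\<gamma> t)) at_top at_top"
begin

abbreviation f :: "complex \<Rightarrow> complex" where "f \<equiv> expmap a"
abbreviation G :: "complex set" where "G \<equiv> \<gamma> ` {0..}"

text \<open>A logarithm of \<open>\<gamma> - a\<close>; the parameter \<open>0\<close> is left out
  because \<open>f\<close> omits the value \<open>a\<close>. Another choice would differ by a
  \<open>vshift\<close> and only renumber the curves below.\<close>

definition lift :: "real \<Rightarrow> complex" where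
  "lift = (SOME g. continuous_on {0<..} g \<and> (\<forall>t>0. exp (g t) = \<gamma> t - a))"

lemma gamma_neq: "t > 0 \<Longrightarrow> \<gamma> t \<noteq> a"
  using inj_onD[OF injective, of t 0] start by fastforce

lemma lift: "continuous_on {0<..} lift" "t > 0 \<Longrightarrow> exp (lift t) = \<gamma> t - a"
proof -
  have "continuous_on {0<..} (\<lambda>t. \<gamma> t - a)"
    by (intro continuous_intros continuous_on_subset[OF continuous]) auto
  moreover have "contractible {0::real<..}"
    by (simp add: convex_imp_contractible)
  ultimately obtain g where "continuous_on {0<..} g" "\<And>t. t \<in> {0<..} \<Longrightarrow> \<gamma> t - a = exp (g t)"
    by (rule continuous_logarithm_on_contractible) (use gamma_neq in auto)
  then have "\<exists>g. continuous_on {0<..} g \<and> (\<forall>t>0. exp (g t) = \<gamma> t - a)" by (metis greaterThan_iff)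
  from someI_ex[OF this]
  show "continuous_on {0<..} lift" "t > 0 \<Longrightarrow> exp (lift t) = \<gamma> t - a"
    unfolding lift_def by blast+
qed

lemma f_lift: "t > 0 \<Longrightarrow> f (lift t) = \<gamma> t"
  using lift(2) by (simp add: expmap_def)

definition curve :: "int \<Rightarrow> complex set" where
  "curve k = (\<lambda>t. lift t + vshift k) ` {0<..}"

lemma preimage_G_iff: "f z \<in> G \<longleftrightarrow> (\<exists>k. z \<in> curve k)"
proof
  assume "f z \<in> G"
  then obtain t where t: "t \<ge> 0" "f z = \<gamma> t" by auto
  moreover have "t \<noteq> 0" using t start expmap_neq[of a z] by auto
  ultimately have "t > 0" "f z = f (lift t)" using f_lift by auto
  then show "\<exists>k. z \<in> curve k"
    unfolding expmap_eq_iff curve_def by auto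
next
  assume "\<exists>k. z \<in> curve k"
  then obtain t k where "t > 0" "z = lift t + vshift k" by (auto simp: curve_def)
  then show "f z \<in> G" using f_lift by simp
qed

lemma curveI [intro]: "t > 0 \<Longrightarrow> lift t + vshift k \<in> curve k"
  by (auto simp: curve_def)

lemma connected_curve: "connected (curve k)"
  unfolding curve_def
  by (intro connected_continuous_image continuous_intros lift(1)) auto

section \<open>Asymptotics of the lift, and paths that must cross its translates\<close>

lemma Re_lift: "t > 0 \<Longrightarrow> Re (lift t) = ln (norm (\<gamma> t - a))"
  by (simp flip: lift(2))

lemma norm_gamma_at_top: "filterlim (\<lambda>t. norm (\<gamma> t)) at_top at_top"
  by (rule filterlim_at_top_mono[OF Re_at_top]) (simp add: complex_Re_le_cmod)

lemma Re_lift_large: "\<exists>s\<ge>u. s > 0 \<and> A \<le> Re (lift s)"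
proof -
  have "eventually (\<lambda>t. exp A + norm a \<le> norm (\<gamma> t)) at_top"
    using norm_gamma_at_top by (simp add: filterlim_at_top)
  then obtain N where N: "\<And>t. t \<ge> N \<Longrightarrow> exp A + norm a \<le> norm (\<gamma> t)"
    by (auto simp: eventually_at_top_linorder)
  define s where "s = \<bar>u\<bar> + \<bar>N\<bar> + 1"
  have s: "s \<ge> u" "s > 0" "s \<ge> N" by (auto simp: s_def)
  then have "exp A \<le> norm (\<gamma> s - a)"
    using N[of s] norm_triangle_ineq2[of "\<gamma> s" a] by linarith
  then have "A \<le> ln (norm (\<gamma> s - a))"
    using ln_ge_iff[of "norm (\<gamma> s - a)" A] by (smt (verit) exp_gt_zero)
  then show ?thesis using s Re_lift by auto
qed

lemma Re_lift_small: "\<exists>s>0. s < u \<and> Re (lift s) \<le> - A" if "u > 0"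
proof -
  obtain d where d: "d > 0" "\<And>t. t \<in> {0..} \<Longrightarrow> dist t 0 < d \<Longrightarrow> dist (\<gamma> t) (\<gamma> 0) < exp (- A)"
    using continuous[unfolded continuous_on_iff, rule_format, of 0 "exp (- A)"] by auto
  define s where "s = min (u/2) (d/2)"
  have s: "s > 0" "s < u" "s < d" using d that by (auto simp: s_def)
  then have "norm (\<gamma> s - a) < exp (- A)"
    using d(2)[of s] start by (simp add: dist_norm)
  moreover have "norm (\<gamma> s - a) > 0" using gamma_neq s by simp
  ultimately have "ln (norm (\<gamma> s - a)) \<le> - A"
    by (metis exp_gt_zero less_imp_le ln_exp ln_less_cancel_iff)
  then show ?thesis using s Re_lift by auto
qed

lemma lift_ends: "\<exists>s t. 0 < s \<and> s < t \<and> Re (lift s) \<le> - A \<and> A \<le> Re (lift t)"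
proof -
  obtain s where "s > 0" "s < 1" "Re (lift s) \<le> - A" using Re_lift_small[of 1 A] by auto
  moreover obtain t where "t \<ge> 1" "A \<le> Re (lift t)" using Re_lift_large[of 1 A] by blast
  ultimately show ?thesis by (intro exI[of _ s] exI[of _ t]) simp
qed

text \<open>The left bound keeps \<open>t\<close> away from \<open>0\<close>, where
  \<open>\<gamma>\<close> is close to \<open>a\<close>. For large \<open>t\<close> the point
  \<open>\<gamma> t\<close> lies to the right of \<open>a\<close>, so
  \<open>cos (Im (lift t))\<close> is positive and \<open>Im (lift t)\<close> cannot pass an odd
  multiple of \<open>pi\<close>. In between, compactness gives the bound.\<close>

lemma bounded_Im_lift: "\<exists>C\<ge>0. \<forall>t>0. - M \<le> Re (lift t) \<longrightarrow> \<bar>Im (lift t)\<bar> \<le> C"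
proof -
  obtain d where d: "d > 0" "\<And>t. t \<in> {0..} \<Longrightarrow> dist t 0 < d \<Longrightarrow> dist (\<gamma> t) (\<gamma> 0) < exp (- M)"
    using continuous[unfolded continuous_on_iff, rule_format, of 0 "exp (- M)"] by auto
  have td: "d \<le> t" if "t > 0" "- M \<le> Re (lift t)" for t
  proof (rule ccontr)
    assume "\<not> d \<le> t"
    then have "norm (\<gamma> t - a) < exp (- M)"
      using d(2)[of t] that start by (simp add: dist_norm)
    moreover have "exp (Re (lift t)) = norm (\<gamma> t - a)"
      by (metis that(1) lift(2) norm_exp_eq_Re)
    moreover have "exp (- M) \<le> exp (Re (lift t))" using that by simp
    ultimately show False by linarith
  qed
  obtain N where N: "\<And>t. t \<ge> N \<Longrightarrow> Re a + 1 \<le> Re (\<gamma> t)"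
    using Re_at_top by (auto simp: filterlim_at_top eventually_at_top_linorder)
  define T where "T = max N d"
  have T: "T > 0" "T \<ge> d" "T \<ge> N" using d by (auto simp: T_def)
  have "continuous_on {d..T} lift" by (rule continuous_on_subset[OF lift(1)]) (use d in auto)
  then have "compact (lift ` {d..T})" by (intro compact_continuous_image) auto
  then obtain D where D: "\<And>r. r \<in> {d..T} \<Longrightarrow> norm (lift r) \<le> D"
    using compact_imp_bounded bounded_iff by (metis image_eqI)
  define x0 where "x0 = Im (lift T)"
  have cosp: "cos (Im (lift t)) > 0" if "t \<ge> T" for t
  proof -
    have "t > 0" using that T by linarith
    then have "Re (exp (lift t)) = Re (\<gamma> t) - Re a" using lift(2) by simp
    then have "0 < exp (Re (lift t)) * cos (Im (lift t))"
      using N[of t] T that by (simp add: Re_exp)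
    then show ?thesis by (simp add: zero_less_mult_iff)
  qed
  have near: "\<bar>Im (lift t) - x0\<bar> \<le> 2 * pi" if t: "t \<ge> T" for t
  proof (rule ccontr)
    assume far: "\<not> ?thesis"
    have conn: "connected ((\<lambda>t. Im (lift t)) ` {T..})"
      by (intro connected_continuous_image continuous_intros continuous_on_subset[OF lift(1)])
        (use T in auto)
    have "\<exists>y. cos y = -1 \<and> y \<in> (\<lambda>t. Im (lift t)) ` {T..}"
    proof -
      \<comment> \<open>Rounding \<open>x0 / (2 * pi)\<close> gives odd multiples of
        \<open>pi\<close> with \<open>?y2 \<le> x0 < ?y1\<close>, both at distance at most
        \<open>2 * pi\<close> from \<open>x0\<close>.\<close>
      define k :: int where "k = \<lfloor>x0 / (2*pi) + 1/2\<rfloor>"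
      have "x0 / (2*pi) - 1/2 < of_int k" "of_int k \<le> x0 / (2*pi) + 1/2"
        unfolding k_def by linarith+
      then have k': "x0 - pi < 2 * pi * of_int k" "2 * pi * of_int k \<le> x0 + pi"
        by (auto simp: field_simps)
      let ?y1 = "2 * pi * of_int k + pi" and ?y2 = "2 * pi * of_int k - pi"
      have y1: "cos ?y1 = -1" and y2: "cos ?y2 = -1"
        using cos_int_2pin[of k] sin_int_2pin[of k] by (simp_all add: cos_add cos_diff)
      have m: "x0 \<in> (\<lambda>t. Im (lift t)) ` {T..}" "Im (lift t) \<in> (\<lambda>t. Im (lift t)) ` {T..}"
        using t x0_def by auto
      show ?thesis
      proof (cases "Im (lift t) > x0 + 2 * pi")
        case True
        then have "x0 \<le> ?y1" "?y1 \<le> Im (lift t)" using k' by linarith+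
        then have "?y1 \<in> (\<lambda>t. Im (lift t)) ` {T..}"
          using conn m unfolding connected_iff_interval by blast
        then show ?thesis using y1 by blast
      next
        case False
        then have "Im (lift t) \<le> ?y2" "?y2 \<le> x0" using k' far by linarith+
        then have "?y2 \<in> (\<lambda>t. Im (lift t)) ` {T..}"
          using conn m unfolding connected_iff_interval by blast
        then show ?thesis using y2 by blast
      qed
    qed
    then show False using cosp by force
  qed
  define C where "C = \<bar>D\<bar> + \<bar>x0\<bar> + 2 * pi"
  have "\<bar>Im (lift t)\<bar> \<le> C" if "t > 0" "- M \<le> Re (lift t)" for t
  proof (cases "t \<ge> T")
    case True
    then show ?thesis using near[OF True] unfolding C_def by linarith
  next
    case False
    then have "norm (lift t) \<le> D" using D td[OF that] by auto
    then show ?thesis using abs_Im_le_cmod[of "lift t"] pi_gt_zero unfolding C_def by linarith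
  qed
  moreover have "C \<ge> 0" using pi_gt_zero unfolding C_def by linarith
  ultimately show ?thesis by blast
qed

text \<open>By translation one constant serves all \<open>k\<close>. Only the end points of
  \<open>p\<close> have to lie right of \<open>- M\<close>; in between, \<open>p\<close> may go
  arbitrarily far to the left.\<close>

lemma path_meets_curve:
  "\<exists>C\<ge>0. \<forall>p k. path p \<and> - M \<le> Re (pathstart p) \<and> - M \<le> Re (pathfinish p) \<and>
     Im (pathstart p) < 2 * pi * of_int k - C \<and> 2 * pi * of_int k + C < Im (pathfinish p)
     \<longrightarrow> path_image p \<inter> curve k \<noteq> {}"
proof -
  obtain C where C: "C \<ge> 0" "\<And>t. t > 0 \<Longrightarrow> - M \<le> Re (lift t) \<Longrightarrow> \<bar>Im (lift t)\<bar> \<le> C"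
    using bounded_Im_lift by blast
  have "path_image p \<inter> curve k \<noteq> {}"
    if p: "path p" "- M \<le> Re (pathstart p)" "- M \<le> Re (pathfinish p)"
      "Im (pathstart p) < 2 * pi * of_int k - C" "2 * pi * of_int k + C < Im (pathfinish p)" for p k
  proof -
    define q where "q = (\<lambda>z. z - vshift k) \<circ> p"
    have q: "path q" unfolding q_def
      using p(1) unfolding path_def comp_def by (intro continuous_intros)
    have "\<exists>t>0. lift t \<in> path_image q"
      by (rule crossing[OF lift(1) lift_ends C(2) q])
        (use p in \<open>auto simp: q_def pathstart_compose pathfinish_compose\<close>)
    then obtain t z where t: "t > 0" "z \<in> path_image p" "lift t = z - vshift k"
      unfolding q_def path_image_compose by auto
    then have "lift t + vshift k = z" by simp
    then show ?thesis using t by (metis curveI disjoint_iff)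
  qed
  then show ?thesis using C(1) by blast
qed

text \<open>A gap of \<open>2 * C + 6 * pi\<close> has room for two neighbouring levels
  \<open>2 * pi * j\<close> and \<open>2 * pi * (j + 1)\<close> with margin \<open>C\<close> on both
  sides. Two curves are wanted because they carry different points with the same image, which will
  contradict an inverse branch of \<open>f\<close>.\<close>

lemma path_meets_two_curves:
  "\<exists>C\<ge>0. \<forall>p. path p \<and> - M \<le> Re (pathstart p) \<and> - M \<le> Re (pathfinish p) \<and>
     C < \<bar>Im (pathfinish p) - Im (pathstart p)\<bar>
     \<longrightarrow> (\<exists>j k. j \<noteq> k \<and> path_image p \<inter> curve j \<noteq> {} \<and> path_image p \<inter> curve k \<noteq> {})"
proof -
  obtain C where C: "C \<ge> 0" "\<And>p k. \<lbrakk>path p; - M \<le> Re (pathstart p); - M \<le> Re (pathfinish p);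
     Im (pathstart p) < 2 * pi * of_int k - C; 2 * pi * of_int k + C < Im (pathfinish p)\<rbrakk>
     \<Longrightarrow> path_image p \<inter> curve k \<noteq> {}"
    using path_meets_curve by metis
  have up: "\<exists>j k. j \<noteq> k \<and> path_image p \<inter> curve j \<noteq> {} \<and> path_image p \<inter> curve k \<noteq> {}"
    if p: "path p" "- M \<le> Re (pathstart p)" "- M \<le> Re (pathfinish p)"
      "2 * C + 6 * pi < Im (pathfinish p) - Im (pathstart p)" for p
  proof -
    define j :: int where "j = \<lfloor>(Im (pathstart p) + C) / (2 * pi)\<rfloor> + 1"
    have "(Im (pathstart p) + C) / (2 * pi) < of_int j"
      "of_int j \<le> (Im (pathstart p) + C) / (2 * pi) + 1"
      unfolding j_def by linarith+
    then have j: "Im (pathstart p) < 2 * pi * of_int j - C"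
      "2 * pi * of_int j \<le> Im (pathstart p) + C + 2 * pi"
      by (auto simp: field_simps)
    have j': "2 * pi * of_int (j + 1) = 2 * pi * of_int j + 2 * pi" by (simp add: algebra_simps)
    have "path_image p \<inter> curve j \<noteq> {}"
      by (rule C(2)) (use p j pi_gt_zero in linarith)+
    moreover have "path_image p \<inter> curve (j + 1) \<noteq> {}"
      by (rule C(2)) (use p j j' pi_gt_zero in linarith)+
    ultimately show ?thesis by (metis add_cancel_left_right zero_neq_one)
  qed
  have "\<exists>j k. j \<noteq> k \<and> path_image p \<inter> curve j \<noteq> {} \<and> path_image p \<inter> curve k \<noteq> {}"
    if p: "path p" "- M \<le> Re (pathstart p)" "- M \<le> Re (pathfinish p)"
      "2 * C + 6 * pi < \<bar>Im (pathfinish p) - Im (pathstart p)\<bar>" for p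
  proof (cases "Im (pathfinish p) \<ge> Im (pathstart p)")
    case True
    then show ?thesis using up[of p] p by auto
  next
    case False
    then show ?thesis using up[of "reversepath p"] p by auto
  qed
  moreover have "2 * C + 6 * pi \<ge> 0" using C(1) pi_gt_zero by linarith
  ultimately show ?thesis by blast
qed

section \<open>Topology of the ray and of its complement\<close>

lemma closed_gamma_tail: "t \<ge> 0 \<Longrightarrow> closed (\<gamma> ` {t..})"
proof -
  assume t: "t \<ge> 0"
  show "closed (\<gamma> ` {t..})"
    unfolding closed_sequential_limits
  proof (intro allI impI)
    fix x l assume xl: "(\<forall>n::nat. x n \<in> \<gamma> ` {t..}) \<and> x \<longlonglongrightarrow> l"
    then have "\<forall>n. \<exists>r. r \<ge> t \<and> x n = \<gamma> r" by auto
    then obtain s where s: "\<And>n. s n \<ge> t" "\<And>n. x n = \<gamma> (s n)" by metis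
    obtain B where B: "\<And>n. norm (x n) \<le> B"
      using convergent_imp_Bseq[OF convergentI, of x l] xl by (auto simp: Bseq_def)
    obtain N where N: "\<And>r. r \<ge> N \<Longrightarrow> B + 1 \<le> norm (\<gamma> r)"
      using norm_gamma_at_top by (auto simp: filterlim_at_top eventually_at_top_linorder)
    have "x n \<in> \<gamma> ` {t..max t N}" for n
      using s(1)[of n] s(2)[of n] B[of n] N[of "s n"] by (cases "s n \<ge> N") auto
    moreover have "closed (\<gamma> ` {t..max t N})"
      by (intro compact_imp_closed compact_continuous_image continuous_on_subset[OF continuous])
        (use t in auto)
    ultimately have "l \<in> \<gamma> ` {t..max t N}"
      using xl closed_sequentially by blast
    then show "l \<in> \<gamma> ` {t..}" by auto
  qed
qed

lemma closed_G: "closed G"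
  using closed_gamma_tail[of 0] by simp

lemma connected_G: "connected G"
  by (intro connected_continuous_image continuous) auto

lemma unbounded_G: "\<not> bounded G"
proof
  assume "bounded G"
  then obtain B where B: "\<And>z. z \<in> G \<Longrightarrow> norm z \<le> B" unfolding bounded_iff by blast
  obtain N where N: "\<And>r. r \<ge> N \<Longrightarrow> B + 1 \<le> norm (\<gamma> r)"
    using norm_gamma_at_top by (auto simp: filterlim_at_top eventually_at_top_linorder)
  show False using N[of "max 0 N"] B[of "\<gamma> (max 0 N)"] by auto
qed

lemma a_in_G: "a \<in> G"
  using start by (metis atLeast_iff image_eqI order_refl)

text \<open>Janiszewski's theorem with a single common point: an arc does not separate the plane,
  and the tail lies to the right of both \<open>x\<close> and \<open>y\<close>, which are therefore
  joined in a half plane.\<close>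

lemma connected_compl_G: "connected (- G)"
  unfolding connected_iff_connected_component
proof (intro ballI)
  fix x y assume xy: "x \<in> - G" "y \<in> - G"
  define R where "R = max (Re x) (Re y)"
  obtain N where N: "\<And>r. r \<ge> N \<Longrightarrow> R + 1 \<le> Re (\<gamma> r)"
    using Re_at_top by (auto simp: filterlim_at_top eventually_at_top_linorder)
  define T where "T = max 1 N"
  have T: "T > 0" "T \<ge> N" by (auto simp: T_def)
  have "{0..} = {0..T} \<union> {T..}" using T by auto
  then have G: "G = \<gamma> ` {0..T} \<union> \<gamma> ` {T..}" by (simp flip: image_Un)
  define g where "g r = \<gamma> (T * r)" for r
  have img: "(\<lambda>r. T * r) ` {0..1} = {0..T}"
    using T by (simp add: image_mult_atLeastAtMost)
  have "arc g"
    unfolding arc_def path_def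
  proof
    show "continuous_on {0..1} g"
      unfolding g_def using T
      by (intro continuous_on_compose2[OF continuous]) (auto intro!: continuous_intros)
    show "inj_on g {0..1}"
      unfolding g_def
    proof (rule inj_onI)
      fix r s assume rs: "r \<in> {0..1}" "s \<in> {0..1}" "\<gamma> (T * r) = \<gamma> (T * s)"
      then have "T * r = T * s" using T by (intro inj_onD[OF injective]) auto
      then show "r = s" using T by simp
    qed
  qed
  moreover have "path_image g = \<gamma> ` {0..T}"
    unfolding path_image_def g_def img[symmetric] by (simp add: image_image)
  ultimately have "connected (- (\<gamma> ` {0..T}))"
    using connected_arc_complement[of g] by simp
  then have 1: "connected_component (- (\<gamma> ` {0..T})) x y"
    using xy G by (auto simp: connected_iff_connected_component)
  have "{z. Re z \<le> R} \<subseteq> - (\<gamma> ` {T..})"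
  proof
    fix z assume "z \<in> {z. Re z \<le> R}"
    moreover have "R + 1 \<le> Re (\<gamma> t)" if "t \<ge> T" for t using N[of t] T that by linarith
    ultimately show "z \<in> - (\<gamma> ` {T..})" by fastforce
  qed
  moreover have "connected {z. Re z \<le> R}"
    by (intro convex_connected convex_halfspace_Re_le)
  ultimately have 2: "connected_component (- (\<gamma> ` {T..})) x y"
    by (intro connected_componentI[of "{z. Re z \<le> R}"]) (auto simp: R_def)
  have "{0..T} \<inter> {T..} = {T}" using T by auto
  then have "\<gamma> ` {0..T} \<inter> \<gamma> ` {T..} = {\<gamma> T}"
    using T inj_on_image_Int[OF injective, of "{0..T}" "{T..}"] by simp
  then have "connected (\<gamma> ` {0..T} \<inter> \<gamma> ` {T..})" by simp
  moreover have "compact (\<gamma> ` {0..T})"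
    by (intro compact_continuous_image continuous_on_subset[OF continuous]) auto
  moreover have "closed (\<gamma> ` {T..})" using closed_gamma_tail T by simp
  ultimately show "connected_component (- G) x y"
    unfolding G by (intro Janiszewski 1 2)
qed

lemma log_off_G:
  obtains l where "continuous_on (- G) l" "\<And>w. w \<notin> G \<Longrightarrow> exp (l w) = w - a"
proof -
  have "- G \<noteq> {}" 
  proof
    assume "- G = {}"
    then have "a - 1 \<in> G" "UNIV = G" by auto
    obtain N where N: "\<And>r. r \<ge> N \<Longrightarrow> Re a + 1 \<le> Re (\<gamma> r)"
      using Re_at_top by (auto simp: filterlim_at_top eventually_at_top_linorder)
    define T where "T = max 0 N"
    have "compact (\<gamma> ` {0..T})"
      by (intro compact_continuous_image continuous_on_subset[OF continuous]) auto
    then obtain B where B: "\<And>z. z \<in> \<gamma> ` {0..T} \<Longrightarrow> norm z \<le> B"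
      using compact_imp_bounded bounded_iff by metis
    \<comment> \<open>A real point too large in modulus for the initial arc and too far left for the
      tail.\<close>
    define z where "z = complex_of_real (- \<bar>B\<bar> - \<bar>Re a\<bar> - 1)"
    obtain t where t: "t \<ge> 0" "z = \<gamma> t" using \<open>UNIV = G\<close> by auto
    have "Re z < Re a + 1" by (simp add: z_def)
    then have "t < N" using N[of t] t by force
    then have "norm z \<le> B" using B[of z] t by (auto simp: T_def)
    then show False unfolding z_def norm_of_real by linarith
  qed
  then have "- G \<in> components (- G)"
    using connected_compl_G in_components_self by blast
  then obtain l where "continuous_on (- G) l" "\<And>w. w \<in> - G \<Longrightarrow> exp (l w) = w - a"
    using log_off_continuum[OF closed_G connected_G unbounded_G a_in_G] by blast
  then show thesis using that by blast
qed

end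

section \<open>Itinerary strips\<close>

locale access_partition = access_ray +
  fixes S0 :: "complex set"
  assumes S0: "S0 \<in> components (- {z. f z \<in> G})"
begin

abbreviation S :: "int \<Rightarrow> complex set" where "S \<equiv> strip S0"

text \<open>The inverse branch of \<open>f\<close> on \<open>- G\<close> with values in
  \<open>S0\<close>; it shows that \<open>f\<close> maps each strip bijectively onto
  \<open>- G\<close>.\<close>

definition L :: "complex \<Rightarrow> complex" where
  "L = (SOME l. continuous_on (- G) l \<and> (\<forall>w. w \<notin> G \<longrightarrow> exp (l w) = w - a) \<and> S0 = l ` (- G))"

text \<open>Any logarithm off \<open>G\<close> can be shifted by a constant so that it inverts
  \<open>f\<close> on \<open>S0\<close>. The image of the connected set \<open>- G\<close> then
  contains \<open>S0\<close> and avoids the lifts, so it equals \<open>S0\<close> by maximality of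
  the component.\<close>

lemma L: "continuous_on (- G) L" "w \<notin> G \<Longrightarrow> exp (L w) = w - a" "S0 = L ` (- G)"
proof -
  obtain l where l: "continuous_on (- G) l" "\<And>w. w \<notin> G \<Longrightarrow> exp (l w) = w - a"
    by (rule log_off_G) blast
  have S0': "connected S0" "S0 \<noteq> {}" "f ` S0 \<subseteq> - G"
    using in_components_connected[OF S0] in_components_nonempty[OF S0] in_components_subset[OF S0]
    by auto
  obtain k where k: "\<And>z. z \<in> S0 \<Longrightarrow> z = l (f z) + vshift k"
    by (rule log_expmap_translate[OF l(1) _ S0'(1,3)]) (use l(2) in auto)
  define l' where "l' w = l w + vshift k" for w
  have l': "continuous_on (- G) l'" "\<And>w. w \<notin> G \<Longrightarrow> exp (l' w) = w - a"
    unfolding l'_def using l by (auto intro!: continuous_intros)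
  have sub: "S0 \<subseteq> l' ` (- G)"
  proof
    fix z assume "z \<in> S0"
    then show "z \<in> l' ` (- G)" using k[of z] S0'(3) unfolding l'_def by blast
  qed
  have fl: "f (l' w) = w" if "w \<notin> G" for w using l'(2)[OF that] by (simp add: expmap_def)
  have "l' ` (- G) \<subseteq> S0"
  proof (rule components_maximal[OF S0])
    show "connected (l' ` (- G))"
      by (rule connected_continuous_image[OF l'(1) connected_compl_G])
    show "l' ` (- G) \<subseteq> - {z. f z \<in> G}" using fl by auto
    show "S0 \<inter> l' ` (- G) \<noteq> {}" using sub S0' by auto
  qed
  then have "\<exists>l. continuous_on (- G) l \<and> (\<forall>w. w \<notin> G \<longrightarrow> exp (l w) = w - a) \<and> S0 = l ` (- G)"
    using l' sub by blast
  from someI_ex[OF this]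
  show "continuous_on (- G) L" "w \<notin> G \<Longrightarrow> exp (L w) = w - a" "S0 = L ` (- G)"
    unfolding L_def by blast+
qed

lemma f_L: "w \<notin> G \<Longrightarrow> f (L w) = w"
  using L(2) by (simp add: expmap_def)

lemma mem_S_iff: "z \<in> S k \<longleftrightarrow> f z \<notin> G \<and> z = L (f z) + vshift k"
proof
  assume "z \<in> S k"
  then obtain w where w: "w \<in> - G" "z = L w + vshift k"
    unfolding strip_vshift using L(3) by (metis imageE)
  then show "f z \<notin> G \<and> z = L (f z) + vshift k" using f_L by simp
next
  assume "f z \<notin> G \<and> z = L (f z) + vshift k"
  then show "z \<in> S k" unfolding strip_vshift using L(3) by blast
qed

lemma S_cover: "f z \<notin> G \<Longrightarrow> \<exists>k. z \<in> S k"
proof -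
  assume "f z \<notin> G"
  then have "f z = f (L (f z))" using f_L by simp
  then show ?thesis unfolding expmap_eq_iff mem_S_iff using \<open>f z \<notin> G\<close> by blast
qed

lemma S_unique: "z \<in> S j \<Longrightarrow> z \<in> S k \<Longrightarrow> j = k"
  unfolding mem_S_iff by (metis add_left_cancel vshift_inject)

lemma inj_on_S: "inj_on f (S k)"
  by (rule inj_onI) (metis mem_S_iff)

lemma open_preimage_compl_G: "open (- {z. f z \<in> G})"
proof -
  have "closed (f -` G)"
    by (rule closed_vimage[OF closed_G]) (intro continuous_intros)
  then show ?thesis by (simp add: vimage_def open_Compl)
qed

lemma open_S: "open (S k)"
  unfolding strip_vshift
  using open_translation[of S0 "vshift k"] open_components[OF open_preimage_compl_G S0]
  by (simp add: add.commute)

lemma connected_S: "connected (S k)"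
  unfolding strip_vshift
  by (intro connected_continuous_image continuous_intros in_components_connected[OF S0])

text \<open>Off the lifts the plane is covered by open, pairwise disjoint strips, and the strip that
  contains \<open>z\<close> has to meet \<open>S k\<close>.\<close>

lemma closure_S: "z \<in> closure (S k) \<Longrightarrow> f z \<notin> G \<Longrightarrow> z \<in> S k"
proof -
  assume z: "z \<in> closure (S k)" "f z \<notin> G"
  then obtain j where j: "z \<in> S j" using S_cover by blast
  then have "S j \<inter> S k \<noteq> {}"
    using z(1) open_Int_closure_eq_empty[OF open_S, of j "S k"] by blast
  then show "z \<in> S k" using S_unique j by blast
qed

lemma connected_in_strip:
  assumes "connected J" "J \<noteq> {}" "\<And>z. z \<in> J \<Longrightarrow> f z \<notin> G"
  obtains k where "J \<subseteq> S k"
proof -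
  obtain k where "\<And>z. z \<in> J \<Longrightarrow> z = L (f z) + vshift k"
    by (rule log_expmap_translate[OF L(1) _ assms(1)]) (use L(2) assms(3) in auto)
  then have "J \<subseteq> S k" using mem_S_iff assms(3) by blast
  then show thesis by (rule that)
qed

lemma connected_in_this_strip:
  assumes "connected J" "z \<in> J" "z \<in> S k" "\<And>z. z \<in> J \<Longrightarrow> f z \<notin> G"
  shows "J \<subseteq> S k"
proof -
  obtain j where "J \<subseteq> S j" using connected_in_strip[of J] assms by blast
  then show ?thesis using S_unique assms by blast
qed

lemma curve_not_S: "z \<in> curve j \<Longrightarrow> z \<notin> S k"
  using preimage_G_iff mem_S_iff by blast

text \<open>A path inside a strip crosses no curve, so if its ends lie right of \<open>- M\<close>,
  their heights differ by a bounded amount. Translation makes the bound uniform in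
  \<open>k\<close>.\<close>

lemma Im_S_bounded:
  "\<exists>C\<ge>0. \<forall>k z. z \<in> S k \<longrightarrow> - M \<le> Re z \<longrightarrow> \<bar>Im z - 2 * pi * of_int k\<bar> \<le> C"
proof -
  obtain C where C: "C \<ge> 0" "\<And>p. \<lbrakk>path p; - M \<le> Re (pathstart p); - M \<le> Re (pathfinish p);
     C < \<bar>Im (pathfinish p) - Im (pathstart p)\<bar>\<rbrakk>
     \<Longrightarrow> \<exists>j k. j \<noteq> k \<and> path_image p \<inter> curve j \<noteq> {} \<and> path_image p \<inter> curve k \<noteq> {}"
    using path_meets_two_curves by metis
  have diam: "\<bar>Im z - Im w\<bar> \<le> C" if zw: "z \<in> S 0" "w \<in> S 0" "- M \<le> Re z" "- M \<le> Re w" for z w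
  proof (rule ccontr)
    assume far: "\<not> ?thesis"
    have "path_connected (S 0)"
      using open_S connected_S connected_open_path_connected by blast
    then obtain p where p: "path p" "path_image p \<subseteq> S 0" "pathstart p = w" "pathfinish p = z"
      using zw unfolding path_connected_def by metis
    obtain j where "path_image p \<inter> curve j \<noteq> {}"
      using C(2)[of p] p zw far by fastforce
    then show False using p(2) curve_not_S by blast
  qed
  have "\<exists>D\<ge>0. \<forall>z\<in>S 0. - M \<le> Re z \<longrightarrow> \<bar>Im z\<bar> \<le> D"
  proof (cases "\<exists>w\<in>S 0. - M \<le> Re w")
    case True
    then obtain w where "w \<in> S 0" "- M \<le> Re w" by blast
    then have "\<forall>z\<in>S 0. - M \<le> Re z \<longrightarrow> \<bar>Im z\<bar> \<le> C + \<bar>Im w\<bar>" using diam[of _ w] by fastforce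
    then show ?thesis using C(1) by (intro exI[of _ "C + \<bar>Im w\<bar>"]) auto
  qed auto
  then obtain D where D: "D \<ge> 0" "\<And>z. z \<in> S 0 \<Longrightarrow> - M \<le> Re z \<Longrightarrow> \<bar>Im z\<bar> \<le> D" by blast
  have "\<bar>Im z - 2 * pi * of_int k\<bar> \<le> D" if "z \<in> S k" "- M \<le> Re z" for k z
  proof -
    have "z - vshift k \<in> S 0" using that unfolding strip_vshift by auto
    then show ?thesis using D(2)[of "z - vshift k"] that by simp
  qed
  then show ?thesis using D(1) by blast
qed

text \<open>Properness of \<open>f\<close> on a strip, away from \<open>a\<close>:
  \<open>norm (f (x n) - a)\<close> is the exponential of the real part, which is thus bounded on
  both sides, and then so is the imaginary part. The limit may lie on the boundary of the
  strip.\<close>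

lemma S_preimage_sequence:
  assumes "\<And>n. x n \<in> S m" "(\<lambda>n. f (x n)) \<longlonglongrightarrow> w" "w \<noteq> a"
  obtains r z where "strict_mono (r :: nat \<Rightarrow> nat)" "(x \<circ> r) \<longlonglongrightarrow> z" "f z = w"
proof -
  have lim: "(\<lambda>n. norm (f (x n) - a)) \<longlonglongrightarrow> norm (w - a)"
    by (intro tendsto_intros assms(2))
  have wa: "norm (w - a) > 0" using assms(3) by simp
  have "eventually (\<lambda>n. norm (w - a) / 2 < norm (f (x n) - a)) sequentially"
    using order_tendstoD(1)[OF lim, of "norm (w - a) / 2"] wa by simp
  moreover have "eventually (\<lambda>n. norm (f (x n) - a) < norm (w - a) + 1) sequentially"
    using order_tendstoD(2)[OF lim, of "norm (w - a) + 1"] by simp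
  ultimately have "eventually (\<lambda>n. norm (w - a) / 2 < norm (f (x n) - a) \<and>
      norm (f (x n) - a) < norm (w - a) + 1) sequentially"
    by eventually_elim simp
  then obtain N where N: "\<And>n. n \<ge> N \<Longrightarrow> norm (w - a) / 2 < exp (Re (x n)) \<and>
      exp (Re (x n)) < norm (w - a) + 1"
    by (auto simp: eventually_sequentially norm_expmap_diff)
  define M where "M = - ln (norm (w - a) / 2)"
  define B where "B = ln (norm (w - a) + 1)"
  have Re: "- M \<le> Re (x n)" "Re (x n) \<le> B" if "n \<ge> N" for n
  proof -
    have "ln (norm (w - a) / 2) \<le> ln (exp (Re (x n)))"
      using N[OF that] wa by (intro ln_mono) auto
    then show "- M \<le> Re (x n)" by (simp add: M_def)
    have "ln (exp (Re (x n))) \<le> ln (norm (w - a) + 1)"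
      using N[OF that] wa by (intro ln_mono) auto
    then show "Re (x n) \<le> B" by (simp add: B_def)
  qed
  obtain C where C: "\<And>k z. z \<in> S k \<Longrightarrow> - M \<le> Re z \<Longrightarrow> \<bar>Im z - 2 * pi * of_int k\<bar> \<le> C"
    using Im_S_bounded by metis
  have "norm (x (n + N)) \<le> \<bar>M\<bar> + \<bar>B\<bar> + \<bar>C\<bar> + \<bar>2 * pi * of_int m\<bar>" for n
    using cmod_le[of "x (n + N)"] Re[of "n + N"] C[OF assms(1)[of "n + N"]] by auto
  then have "bounded (range (\<lambda>n. x (n + N)))" unfolding bounded_iff by blast
  then obtain z r where r: "strict_mono (r :: nat \<Rightarrow> nat)" "((\<lambda>n. x (n + N)) \<circ> r) \<longlonglongrightarrow> z"
    using bounded_imp_convergent_subsequence by metis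
  define r' where "r' n = r n + N" for n
  have r': "strict_mono r'" "(x \<circ> r') \<longlonglongrightarrow> z"
    using r by (auto simp: r'_def strict_mono_def o_def)
  have "isCont f z" 
    using continuous_on_expmap[OF continuous_on_id, of UNIV a] by (simp add: continuous_on_eq_continuous_at)
  then have "(\<lambda>n. f ((x \<circ> r') n)) \<longlonglongrightarrow> f z"
    using r'(2) isCont_tendsto_compose by blast
  moreover have "(\<lambda>n. f ((x \<circ> r') n)) \<longlonglongrightarrow> w"
    using LIMSEQ_subseq_LIMSEQ[OF assms(2) r'(1)] by (simp add: o_def)
  ultimately have "f z = w" using LIMSEQ_unique by blast
  then show thesis using that r' by blast
qed

text \<open>The only finite limit of \<open>f\<close> along \<open>P\<close> that need not be
  attained is \<open>a\<close>, approached where \<open>P\<close> goes to the left.\<close>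

lemma closed_insert_image:
  assumes "closed P" "P \<subseteq> S m"
  shows "closed (insert a (f ` P))"
  unfolding closed_sequential_limits
proof (intro allI impI)
  fix y l assume y: "(\<forall>n::nat. y n \<in> insert a (f ` P)) \<and> y \<longlonglongrightarrow> l"
  show "l \<in> insert a (f ` P)"
  proof (cases "l = a")
    case False
    then have "eventually (\<lambda>n. y n \<noteq> a) sequentially"
      using y tendsto_imp_eventually_ne by blast
    then obtain N where N: "\<And>n. n \<ge> N \<Longrightarrow> y n \<noteq> a" by (auto simp: eventually_sequentially)
    then have "\<forall>n. \<exists>x\<in>P. y (n + N) = f x" using y by (metis image_iff insertE le_add2)
    then obtain x where x: "\<And>n. x n \<in> P" "\<And>n. y (n + N) = f (x n)" by metis
    have "(\<lambda>n. f (x n)) \<longlonglongrightarrow> l"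
      using LIMSEQ_ignore_initial_segment[of y l N] y by (simp add: x(2))
    then obtain r z where "strict_mono (r :: nat \<Rightarrow> nat)" "(x \<circ> r) \<longlonglongrightarrow> z" "f z = l"
      using S_preimage_sequence[of x m l] x(1) assms(2) False by blast
    moreover have "z \<in> P"
      using closed_sequentially[OF assms(1), of "x \<circ> r" z] x(1) calculation by auto
    ultimately show ?thesis by auto
  qed simp
qed

lemma closed_image:
  assumes "closed P" "P \<subseteq> S m" "\<And>z. z \<in> P \<Longrightarrow> - R \<le> Re z"
  shows "closed (f ` P)"
proof -
  have "f ` P = insert a (f ` P) \<inter> {w. exp (- R) \<le> norm (w - a)}"
    using assms(3) by (auto simp: norm_expmap_diff)
  moreover have "closed {w. exp (- R) \<le> norm (w - a)}"
    by (intro closed_Collect_le continuous_intros)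
  ultimately show ?thesis using closed_insert_image[OF assms(1,2)] by (metis closed_Int)
qed

text \<open>If at most one strip accumulated at \<open>z\<close>, then \<open>L\<close> would have
  the same limit at \<open>\<gamma> t\<close> from all directions. Across a short piece of the ray,
  \<open>L\<close> and the lift would glue to a logarithm of \<open>w - a\<close> around the compact
  initial arc, contrary to \<open>no_log_around_compact\<close>.\<close>

lemma closure_two_strips:
  assumes z: "f z \<in> G"
  obtains j k where "j \<noteq> k" "z \<in> closure (S j)" "z \<in> closure (S k)"
proof (rule ccontr)
  assume no: "\<not> thesis"
  obtain t m where t: "t > 0" and zt: "z = lift t + vshift m"
    using z unfolding preimage_G_iff curve_def by auto
  have "\<exists>K. \<forall>k. z \<in> closure (S k) \<longrightarrow> k = K" using no that by metis
  then obtain K where K: "\<And>k. z \<in> closure (S k) \<Longrightarrow> k = K" by blast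
  define c where "c = lift t + vshift (m - K)"
  \<comment> \<open>\<open>c\<close> is the only possible limit of \<open>L\<close> at
    \<open>\<gamma> t\<close>: a limit \<open>lift t + vshift i\<close>, translated to
    \<open>z\<close>, puts \<open>z\<close> into the closure of \<open>S (m - i)\<close>, so
    \<open>m - i = K\<close>.\<close>
  have "\<exists>d>0. \<forall>w. w \<notin> G \<longrightarrow> dist w (\<gamma> t) < d \<longrightarrow> dist (L w) c < 1"
  proof (rule ccontr)
    assume "\<not> ?thesis"
    then have "\<forall>n. \<exists>w. w \<notin> G \<and> dist w (\<gamma> t) < inverse (real (Suc n)) \<and> 1 \<le> dist (L w) c"
      by (metis inverse_positive_iff_positive not_le of_nat_0_less_iff zero_less_Suc)
    then obtain y where y: "\<And>n. y n \<notin> G" "\<And>n. dist (y n) (\<gamma> t) < inverse (real (Suc n))"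
      "\<And>n. 1 \<le> dist (L (y n)) c" by metis
    have "y \<longlonglongrightarrow> \<gamma> t"
    proof (rule metric_tendsto_imp_tendsto)
      show "(\<lambda>n. inverse (real (Suc n))) \<longlonglongrightarrow> 0" by (rule LIMSEQ_inverse_real_of_nat)
      have "dist (y n) (\<gamma> t) \<le> dist (inverse (real (Suc n))) 0" for n
        using y(2)[of n] by (simp add: dist_real_def)
      then show "\<forall>\<^sub>F n in sequentially. dist (y n) (\<gamma> t) \<le> dist (inverse (real (Suc n))) 0"
        by simp
    qed
    then have "(\<lambda>n. f (L (y n))) \<longlonglongrightarrow> \<gamma> t" using f_L[OF y(1)] by simp
    moreover have "L (y n) \<in> S 0" for n
      using y(1) f_L by (simp add: mem_S_iff)
    ultimately obtain r z' where r: "strict_mono (r :: nat \<Rightarrow> nat)"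
      "((\<lambda>n. L (y n)) \<circ> r) \<longlonglongrightarrow> z'" "f z' = \<gamma> t"
      using S_preimage_sequence[of "\<lambda>n. L (y n)" 0] gamma_neq[OF t] by blast
    have "f z' = f (lift t)" using r(3) f_lift[OF t] by simp
    then obtain i where i: "z' = lift t + vshift i" unfolding expmap_eq_iff by blast
    have "((\<lambda>n. L (y n)) \<circ> r) n \<in> S 0" for n
      using \<open>\<And>n. L (y n) \<in> S 0\<close> by simp
    then have "z' \<in> closure (S 0)"
      unfolding closure_sequential using r(2) by blast
    then have "z' + vshift (m - i) \<in> closure (S (m - i))"
      using closure_translation[of "vshift (m - i)" S0] unfolding strip_vshift
      by (simp add: add.commute image_iff)
    moreover have "z' + vshift (m - i) = z" by (simp add: i zt vshift_diff)
    ultimately have "m - i = K" using K by simp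
    then have "z' = c" unfolding c_def i by auto
    then have "(\<lambda>n. dist (L (y (r n))) c) \<longlonglongrightarrow> 0"
      using r(2) tendsto_dist_iff[of "(\<lambda>n. L (y n)) \<circ> r" c] by (simp add: o_def)
    then have "(1::real) \<le> 0"
      by (rule LIMSEQ_le_const) (use y(3) in auto)
    then show False by simp
  qed
  then obtain d where d: "d > 0" "\<And>w. w \<notin> G \<Longrightarrow> dist w (\<gamma> t) < d \<Longrightarrow> dist (L w) c < 1" by blast
  have "isCont \<gamma> t" "isCont lift t"
    using continuous_on_interior[OF continuous] continuous_on_interior[OF lift(1)] t
    by (auto simp: interior_open)
  then obtain e1 e2 where e: "e1 > 0" "e2 > 0" "\<And>s. dist s t < e1 \<Longrightarrow> dist (\<gamma> s) (\<gamma> t) < d"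
    "\<And>s. dist s t < e2 \<Longrightarrow> dist (lift s) (lift t) < 1"
    unfolding continuous_at_eps_delta using d(1) by (metis zero_less_one)
  define e where "e = min (t/2) (min e1 e2) / 2"
  have e': "e > 0" "e < t" "e < e1" "e < e2" using e t by (auto simp: e_def min_def)
  define T where "T = \<gamma> ` {0..t - e}"
  define H where "H = \<gamma> ` {t + e..}"
  have gTH: "\<gamma> s \<in> T \<union> H \<longleftrightarrow> s \<le> t - e \<or> t + e \<le> s" if "s \<ge> 0" for s
  proof
    assume "\<gamma> s \<in> T \<union> H"
    then obtain r where "\<gamma> s = \<gamma> r" "r \<in> {0..t-e} \<union> {t+e..}" by (auto simp: T_def H_def)
    then show "s \<le> t - e \<or> t + e \<le> s"
      using inj_onD[OF injective, of s r] that e' by auto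
  qed (use that in \<open>auto simp: T_def H_def\<close>)
  define l where "l w = (if w \<in> G then lift (inv_into {0..} \<gamma> w) + vshift (m - K) else L w)" for w
  have lg: "l (\<gamma> s) = lift s + vshift (m - K)" if "s > 0" for s
    using that inv_into_f_f[OF injective, of s] by (simp add: l_def)
  show False
  proof (rule no_log_around_compact)
    show "compact T" unfolding T_def
      by (intro compact_continuous_image continuous_on_subset[OF continuous]) auto
    show "closed H" unfolding H_def using closed_gamma_tail e' t by simp
    show "T \<inter> H = {}"
      unfolding T_def H_def using e' t
      by (auto dest: inj_onD[OF injective])
    show "a \<in> T" unfolding T_def using start e' t by (intro image_eqI[of _ _ 0]) auto
    show "exp (l w) = w - a" if "w \<notin> T \<union> H" for w
    proof (cases "w \<in> G")
      case True
      then obtain s where "s \<ge> 0" "w = \<gamma> s" by auto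
      moreover from this have "s > 0" using that gTH[of s] e' by auto
      ultimately show ?thesis using lg lift(2) by simp
    qed (use L in \<open>simp add: l_def\<close>)
    have TH: "closed (T \<union> H)" using \<open>compact T\<close> \<open>closed H\<close> compact_imp_closed closed_Un by blast
    let ?U = "- (T \<union> H) \<inter> ball (\<gamma> t) d"
    have near: "dist (l w) c < 1" if w: "w \<in> ?U" for w
    proof (cases "w \<in> G")
      case True
      then obtain s where s: "s \<ge> 0" "w = \<gamma> s" by auto
      then have "t - e < s" "s < t + e" using w gTH[of s] by auto
      then have "dist s t < e2" "s > 0" using e' by (auto simp: dist_real_def)
      then show ?thesis using e(4)[of s] lg s by (simp add: c_def)
    qed (use d w in \<open>simp add: l_def dist_commute\<close>)
    \<comment> \<open>Near \<open>\<gamma> t\<close> the values of \<open>l\<close> are within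
      \<open>1 < pi\<close> of \<open>c\<close>, so \<open>l\<close> agrees with this shifted
      principal logarithm and inherits its continuity.\<close>
    have "continuous_on ?U (\<lambda>w. c + Ln ((w - a) / exp c))"
    proof (intro continuous_intros ballI)
      fix w assume w: "w \<in> ?U"
      then have "(w - a) / exp c = exp (l w - c)"
        using \<open>\<And>w. w \<notin> T \<union> H \<Longrightarrow> exp (l w) = w - a\<close> by (simp add: exp_diff)
      moreover have "\<bar>Im (l w - c)\<bar> < 1"
        using near[OF w] abs_Im_le_cmod[of "l w - c"] by (simp add: dist_norm)
      then have "cos (Im (l w - c)) > 0" using pi_gt3 by (intro cos_gt_zero_pi) auto
      then have "Re (exp (l w - c)) > 0" by (simp only: Re_exp) simp
      ultimately show "(w - a) / exp c \<notin> \<real>\<^sub>\<le>\<^sub>0"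
        using complex_nonpos_Reals_iff by auto
    qed auto
    moreover have "c + Ln ((w - a) / exp c) = l w" if w: "w \<in> ?U" for w
    proof -
      have "(w - a) / exp c = exp (l w - c)"
        using w \<open>\<And>w. w \<notin> T \<union> H \<Longrightarrow> exp (l w) = w - a\<close> by (simp add: exp_diff)
      moreover have "\<bar>Im (l w - c)\<bar> < 1"
        using near[OF w] abs_Im_le_cmod[of "l w - c"] by (simp add: dist_norm)
      then have "Ln (exp (l w - c)) = l w - c" using pi_gt3 by (intro Ln_exp) auto
      ultimately show ?thesis by simp
    qed
    ultimately have 1: "continuous_on ?U l"
      by (rule continuous_on_eq) 
    have "continuous_on (- G) l" by (rule continuous_on_eq[OF L(1)]) (simp add: l_def)
    moreover have "open ?U" "open (- G)" using TH closed_G by (intro open_Int open_Compl open_ball; simp)+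
    ultimately have "continuous_on (- G \<union> ?U) l"
      using 1 by (intro continuous_on_open_Un)
    moreover have "- (T \<union> H) \<subseteq> - G \<union> ?U"
    proof
      fix w assume w: "w \<in> - (T \<union> H)"
      show "w \<in> - G \<union> ?U"
      proof (cases "w \<in> G")
        case True
        then obtain s where s: "s \<ge> 0" "w = \<gamma> s" by auto
        then have "t - e < s" "s < t + e" using w gTH[of s] by auto
        then have "dist s t < e1" using e' by (auto simp: dist_real_def)
        then show ?thesis using e(3)[of s] s w by (simp add: dist_commute)
      qed auto
    qed
    ultimately show "continuous_on (- (T \<union> H)) l"
      using continuous_on_subset by blast
  qed
qed

end

section \<open>Escaping points off the singular orbit\<close>

context access_ray
begin

abbreviation I :: "complex set" where "I \<equiv> escaping_set f"

definition Orb :: "complex set" where "Orb = range (\<lambda>n. (f ^^ n) a)"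

definition E :: "complex set" where "E = I - Orb"

lemma norm_f_le: "norm (f z) \<le> exp (Re z) + norm a"
  using norm_triangle_ineq[of "exp z" a] by (simp add: expmap_def)

lemma norm_f_ge: "exp (Re z) - norm a \<le> norm (f z)"
  using norm_diff_ineq[of "exp z" a] by (simp add: expmap_def)

text \<open>The modulus of \<open>f w\<close> is at most \<open>exp (Re w) + norm a\<close>, so a
  large next iterate forces a large real part now.\<close>

lemma escaping_iff: "z \<in> I \<longleftrightarrow> filterlim (\<lambda>n. Re ((f ^^ n) z)) at_top sequentially"
proof
  assume "z \<in> I"
  then have lim: "filterlim (\<lambda>n. norm ((f ^^ n) z)) at_top sequentially"
    by (simp add: escaping_set_def filterlim_at_infinity_conv_norm_at_top)
  show "filterlim (\<lambda>n. Re ((f ^^ n) z)) at_top sequentially"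
    unfolding filterlim_at_top
  proof
    fix B :: real
    have "eventually (\<lambda>n. exp B + norm a \<le> norm ((f ^^ n) z)) sequentially"
      using lim by (simp add: filterlim_at_top)
    then have "eventually (\<lambda>n. exp B + norm a \<le> norm ((f ^^ Suc n) z)) sequentially"
      by (rule eventually_sequentially_Suc[THEN iffD2])
    then show "eventually (\<lambda>n. B \<le> Re ((f ^^ n) z)) sequentially"
    proof eventually_elim
      case (elim n)
      then have "exp B \<le> exp (Re ((f ^^ n) z))"
        using norm_f_le[of "(f ^^ n) z"] by (simp del: exp_le_cancel_iff)
      then show ?case by simp
    qed
  qed
next
  assume "filterlim (\<lambda>n. Re ((f ^^ n) z)) at_top sequentially"
  then have "filterlim (\<lambda>n. norm ((f ^^ n) z)) at_top sequentially"
    by (rule filterlim_at_top_mono) (simp add: complex_Re_le_cmod)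
  then show "z \<in> I"
    by (simp add: escaping_set_def filterlim_at_infinity_conv_norm_at_top)
qed

lemma f_escaping [simp]: "f z \<in> I \<longleftrightarrow> z \<in> I"
proof -
  have "(\<lambda>n. Re ((f ^^ n) (f z))) = (\<lambda>n. Re ((f ^^ Suc n) z))" by (simp add: funpow_swap1)
  then show ?thesis
    unfolding escaping_iff using filterlim_sequentially_Suc[of "\<lambda>n. Re ((f ^^ n) z)"] by simp
qed

lemma funpow_escaping [simp]: "(f ^^ n) z \<in> I \<longleftrightarrow> z \<in> I"
  by (induction n) auto

lemma Orb_forward: "z \<in> Orb \<Longrightarrow> f z \<in> Orb"
proof -
  assume "z \<in> Orb"
  then obtain n where "z = (f ^^ n) a" by (auto simp: Orb_def)
  then have "f z = (f ^^ Suc n) a" by simp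
  then show "f z \<in> Orb" unfolding Orb_def by blast
qed

lemma E_backward: "f z \<in> E \<Longrightarrow> z \<in> E"
  unfolding E_def using Orb_forward f_escaping by blast

lemma E_backward_funpow: "(f ^^ n) z \<in> E \<Longrightarrow> z \<in> E"
  by (induction n) (auto dest: E_backward)

lemma a_notin_E: "a \<notin> E"
  unfolding E_def Orb_def by (metis DiffD2 funpow_0 rangeI)

lemma image_disjoint_E: "A \<inter> E = {} \<Longrightarrow> f ` A \<inter> E = {}"
  using E_backward by blast

lemma funpow_image_disjoint_E: "A \<inter> E = {} \<Longrightarrow> (f ^^ n) ` A \<inter> E = {}"
  using E_backward_funpow by blast

text \<open>By Bloch's theorem the iterates of a small disk around an escaping point contain large disks,
  and every large disk meets a lift of the ray.\<close>
lemma ray_preimages_dense: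
  assumes "z \<in> I" "open U" "z \<in> U"
  obtains w n t where "w \<in> U" "t > 0" "(f ^^ n) w = \<gamma> t"
proof -
  obtain r where r: "r > 0" "ball z r \<subseteq> U" using assms open_contains_ball by blast
  have D: "((f ^^ n) has_field_derivative (\<Prod>j<n. exp ((f ^^ j) z))) (at z)" for n
  proof (induction n)
    case 0
    have "((\<lambda>x. x) has_field_derivative 1) (at z)" by (rule DERIV_ident)
    then show ?case by (simp add: id_def)
  next
    case (Suc n)
    have "(f has_field_derivative exp ((f ^^ n) z)) (at ((f ^^ n) z))"
      unfolding expmap_def by (auto intro!: derivative_eq_intros)
    from DERIV_chain[OF this Suc] show ?case by (simp add: mult.commute o_def)
  qed
  obtain N where N: "\<And>n. n \<ge> N \<Longrightarrow> 1 \<le> Re ((f ^^ n) z)"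
    using assms(1) by (auto simp: escaping_iff filterlim_at_top eventually_sequentially)
  define p where "p n = norm (\<Prod>j<n. exp ((f ^^ j) z))" for n
  have pos: "p n > 0" for n by (simp add: p_def)
  have grow: "p N * 2 ^ m \<le> p (N + m)" for m
  proof (induction m)
    case (Suc m)
    have "(2::real) \<le> exp 1" using exp_ge_add_one_self[of 1] by simp
    also have "\<dots> \<le> exp (Re ((f ^^ (N + m)) z))" using N[of "N + m"] by simp
    finally have "p (N + m) * 2 \<le> p (N + m) * exp (Re ((f ^^ (N + m)) z))"
      using pos by simp
    moreover have "p (N + Suc m) = p (N + m) * exp (Re ((f ^^ (N + m)) z))"
      by (simp add: p_def norm_mult)
    ultimately show ?case using Suc by simp
  qed simp
  \<comment> \<open>\<open>96 = 12 * 8\<close>: Bloch's theorem with constant \<open>1 / 12\<close>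
    gives a disk of radius \<open>8 > 2 * pi\<close>. The real part of the lift takes every value,
    so some point of the lift has a translate in that disk.\<close>
  obtain m where "96 / (r * p N) < 2 ^ m" using real_arch_pow[of 2] by auto
  then have "96 < r * (p N * 2 ^ m)" using pos[of N] r by (simp add: field_simps)
  also have "\<dots> \<le> r * p (N + m)" using grow r by (intro mult_left_mono) auto
  finally have big: "8 \<le> r * norm (deriv (f ^^ (N + m)) z) / 12"
    using DERIV_imp_deriv[OF D] by (simp add: p_def)
  have "(f ^^ n) holomorphic_on A" for n A
  proof (induction n)
    case (Suc n)
    show ?case
      using holomorphic_on_compose[OF Suc holomorphic_expmap] by (simp add: o_def)
  qed (simp add: id_def holomorphic_on_ident)
  then obtain b where b: "ball b 8 \<subseteq> (f ^^ (N + m)) ` ball z r"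
    using Bloch[OF _ r(1) big] by blast
  have "\<exists>s>0. Re (lift s) = Re b"
  proof -
    obtain s t where st: "0 < s" "s < t" "Re (lift s) \<le> - \<bar>Re b\<bar>" "\<bar>Re b\<bar> \<le> Re (lift t)"
      using lift_ends by blast
    have "continuous_on {s..t} (\<lambda>x. Re (lift x))"
      by (intro continuous_intros continuous_on_subset[OF lift(1)]) (use st in auto)
    moreover have "Re (lift s) \<le> Re b" "Re b \<le> Re (lift t)" using st by linarith+
    ultimately obtain x where "s \<le> x" "x \<le> t" "Re (lift x) = Re b"
      using IVT'[of "\<lambda>x. Re (lift x)" s "Re b" t] st(2) by auto
    then show ?thesis using st by (intro exI[of _ x]) auto
  qed
  then obtain s where s: "s > 0" "Re (lift s) = Re b" by blast
  define k :: int where "k = \<lfloor>(Im b - Im (lift s)) / (2 * pi)\<rfloor>"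
  have "of_int k \<le> (Im b - Im (lift s)) / (2 * pi)" "(Im b - Im (lift s)) / (2 * pi) < of_int k + 1"
    unfolding k_def by linarith+
  then have "2 * pi * of_int k \<le> Im b - Im (lift s)" "Im b - Im (lift s) < 2 * pi * of_int k + 2 * pi"
    by (auto simp: field_simps)
  then have "\<bar>Im (lift s + vshift k - b)\<bar> \<le> 2 * pi" by simp
  moreover have "norm (lift s + vshift k - b) \<le> \<bar>Re (lift s + vshift k - b)\<bar> + \<bar>Im (lift s + vshift k - b)\<bar>"
    by (rule cmod_le)
  ultimately have "dist (lift s + vshift k) b < 8"
    using s(2) pi_less_4 by (simp add: dist_norm)
  then obtain y where y: "y \<in> ball z r" "(f ^^ (N + m)) y = lift s + vshift k"
    using b by (metis (no_types, lifting) dist_commute imageE mem_ball subsetD)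
  then have "(f ^^ Suc (N + m)) y = \<gamma> s" using f_lift[OF s(1)] by simp
  then show thesis using that[of y s "Suc (N + m)"] y r s by blast
qed

end

context access_partition
begin

text \<open>Right of \<open>- R\<close> a strip has bounded height, so a large modulus must come
  from the real part.\<close>

lemma Re_large_if_norm_large:
  assumes "Q \<subseteq> S m" "\<And>w. w \<in> Q \<Longrightarrow> - R \<le> Re w"
  obtains \<rho> where "\<And>w. w \<in> Q \<Longrightarrow> \<rho> \<le> norm w \<Longrightarrow> B \<le> Re w"
proof -
  obtain C where C: "\<And>k z. z \<in> S k \<Longrightarrow> - R \<le> Re z \<Longrightarrow> \<bar>Im z - 2 * pi * of_int k\<bar> \<le> C"
    using Im_S_bounded by metis
  have "B \<le> Re w" if w: "w \<in> Q" "\<bar>B\<bar> + \<bar>R\<bar> + \<bar>C\<bar> + \<bar>2 * pi * of_int m\<bar> + 1 \<le> norm w" for w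
  proof -
    have "\<bar>Im w\<bar> \<le> \<bar>C\<bar> + \<bar>2 * pi * of_int m\<bar>" using C[of w m] assms w by fastforce
    then show ?thesis using cmod_le[of w] assms(2)[OF w(1)] w(2) by linarith
  qed
  then show thesis by (rule that)
qed

text \<open>The points of \<open>P\<close> far out whose orbit stays in the right half plane up to time \<open>n\<close> form a
  relatively clopen set, because the bound on imaginary parts keeps them off the imaginary axis.\<close>
lemma controlled_continuum_meets_E:
  assumes P: "closed P" "connected P" "\<not> bounded P" "P \<inter> E = {}"
    and strips: "\<And>n. \<exists>m. (f ^^ n) ` P \<subseteq> S m"
    and left: "\<And>n. \<exists>R. \<forall>x\<in>P. - R \<le> Re ((f ^^ n) x)"
    and im: "\<And>n x. x \<in> P \<Longrightarrow> 0 \<le> Re ((f ^^ n) x) \<Longrightarrow> \<bar>Im ((f ^^ n) x)\<bar> \<le> g n + C"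
    and g: "0 \<le> g 0" "\<And>n. g (Suc n) = exp (g n) + norm a"
  shows False
proof -
  have g_ge: "real n \<le> g n" for n
  proof (induction n)
    case (Suc n)
    then show ?case using exp_ge_add_one_self[of "g n"] g(2)[of n] norm_ge_zero[of a] 
      unfolding of_nat_Suc by linarith
  qed (use g in simp)
  \<comment> \<open>Chosen for \<open>step\<close>: a real part of at least \<open>g j + D\<close>
    makes the next modulus at least \<open>exp (g j) * exp D - norm a\<close>. Subtracting the bound
    on the imaginary part must leave \<open>g (Suc j) + D\<close>, so the factor
    \<open>exp D\<close> has to pay for
    \<open>2 * exp (g j) + 3 * norm a + \<bar>C\<bar> + D\<close>.\<close>
  define D where "D = 3 * norm a + \<bar>C\<bar> + 2"
  have D0: "D \<ge> 2" by (simp add: D_def)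
  have expD: "3 * norm a + \<bar>C\<bar> + D \<le> exp D - 2"
  proof -
    have "1 + D + D\<^sup>2 / 2 \<le> exp D" using D0 by (intro exp_lower_Taylor_quadratic) simp
    moreover have "2 * D \<le> D\<^sup>2" using D0 by (simp add: power2_eq_square)
    ultimately have "1 + 2 * D \<le> exp D" by simp
    then show ?thesis unfolding D_def by simp
  qed
  \<comment> \<open>At each fixed time, uniformly over \<open>P\<close>: a large real part gives a
    large next modulus, which the strip and the left bound turn back into a large real part.\<close>
  have far: "\<exists>\<rho>. \<forall>x\<in>P. \<rho> \<le> norm x \<longrightarrow> B \<le> Re ((f ^^ n) x)" for n B
  proof (induction n arbitrary: B)
    case 0
    obtain m where "(f ^^ 0) ` P \<subseteq> S m" using strips by blast
    moreover obtain R where "\<forall>x\<in>P. - R \<le> Re ((f ^^ 0) x)" using left by blast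
    ultimately obtain \<rho> where "\<And>w. w \<in> P \<Longrightarrow> \<rho> \<le> norm w \<Longrightarrow> B \<le> Re w"
      using Re_large_if_norm_large[of P m R B] by auto
    then show ?case by auto
  next
    case (Suc n)
    obtain m where m: "(f ^^ Suc n) ` P \<subseteq> S m" using strips by blast
    obtain R where R: "\<forall>x\<in>P. - R \<le> Re ((f ^^ Suc n) x)" using left by blast
    obtain \<rho> where \<rho>: "\<And>w. w \<in> (f ^^ Suc n) ` P \<Longrightarrow> \<rho> \<le> norm w \<Longrightarrow> B \<le> Re w"
      using Re_large_if_norm_large[OF m, of R B] R by blast
    obtain \<rho>' where \<rho>': "\<forall>x\<in>P. \<rho>' \<le> norm x \<longrightarrow> \<bar>\<rho>\<bar> + norm a \<le> Re ((f ^^ n) x)"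
      using Suc by blast
    have "B \<le> Re ((f ^^ Suc n) x)" if "x \<in> P" "\<rho>' \<le> norm x" for x
    proof (rule \<rho>)
      have "\<bar>\<rho>\<bar> + norm a \<le> exp (Re ((f ^^ n) x))"
        using \<rho>'[rule_format, OF that] exp_ge_add_one_self[of "Re ((f ^^ n) x)"] by linarith
      then show "\<rho> \<le> norm ((f ^^ Suc n) x)" using norm_f_ge[of "(f ^^ n) x"] by simp
    qed (use that in blast)
    then show ?case by blast
  qed
  have "P \<noteq> {}" using P(3) by auto
  then obtain p0 where p0: "p0 \<in> P" by blast
  obtain \<rho>0 where \<rho>0: "\<And>x. x \<in> P \<Longrightarrow> \<rho>0 \<le> norm x \<Longrightarrow> g 0 + D \<le> Re x"
    using far[of "g 0 + D" 0] by auto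
  define \<rho> where "\<rho> = max \<rho>0 (norm p0 + 1)"
  define good where "good n = {x\<in>P. \<rho> \<le> norm x \<and> (\<forall>j\<le>n. 0 < Re ((f ^^ j) x))}" for n
  have step: "g (Suc j) + D \<le> Re ((f ^^ Suc j) x)"
    if "x \<in> P" "g j + D \<le> Re ((f ^^ j) x)" "0 \<le> Re ((f ^^ Suc j) x)" for j x
  proof -
    let ?w = "(f ^^ Suc j) x"
    have "exp (g j + D) \<le> exp (Re ((f ^^ j) x))" using that by simp
    then have 1: "exp (g j) * exp D - norm a \<le> norm ?w"
      using norm_f_ge[of "(f ^^ j) x"] by (simp add: exp_add)
    have 2: "\<bar>Im ?w\<bar> \<le> exp (g j) + norm a + \<bar>C\<bar>" using im[OF that(1,3)] g(2)[of j] by simp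
    have "1 \<le> exp (g j)" using g_ge[of j] by simp
    moreover have "0 \<le> exp D - 2"
      using expD D0 norm_ge_zero[of a] abs_ge_zero[of C] by linarith
    ultimately have "1 * (exp D - 2) \<le> exp (g j) * (exp D - 2)"
      by (rule mult_right_mono)
    then have 3: "3 * norm a + \<bar>C\<bar> + D \<le> exp (g j) * exp D - 2 * exp (g j)"
      using expD by (simp add: algebra_simps)
    show ?thesis using 1 2 3 cmod_le[of ?w] that(3) g(2)[of j] by linarith
  qed
  have good_bound: "g j + D \<le> Re ((f ^^ j) x)" if "x \<in> good n" "j \<le> n" for x n j
    using that(2)
  proof (induction j)
    case 0
    then show ?case using that(1) \<rho>0[of x] by (auto simp: good_def \<rho>_def)
  next
    case (Suc j)
    then show ?case using step[of x j] that(1) by (auto simp: good_def less_imp_le)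
  qed
  have cont: "continuous_on A (\<lambda>x. Re ((f ^^ n) x))" for n A
    using continuous_on_expmap_funpow[of A n a] by (intro continuous_intros)
  have closed_good: "closed (good n)" for n
  proof (induction n)
    case 0
    have "0 < g 0 + D" using g(1) D0 by simp
    then have "good 0 = P \<inter> {x. \<rho> \<le> norm x}"
      unfolding good_def using \<rho>0 by (force simp: \<rho>_def)
    moreover have "closed {x::complex. \<rho> \<le> norm x}"
      by (intro closed_Collect_le continuous_intros)
    ultimately show ?case using P(1) by (simp add: closed_Int)
  next
    case (Suc n)
    \<comment> \<open>By \<open>step\<close> a nonnegative next real part is already large, so the
      strict inequality may be replaced by a closed condition.\<close>
    have "good (Suc n) = good n \<inter> {x. 0 \<le> Re ((f ^^ Suc n) x)}"
    proof (intro equalityI subsetI)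
      fix x assume x: "x \<in> good n \<inter> {x. 0 \<le> Re ((f ^^ Suc n) x)}"
      then have "g (Suc n) + D \<le> Re ((f ^^ Suc n) x)"
        using step[of x n] good_bound[of x n n] by (auto simp: good_def)
      then have "0 < Re ((f ^^ Suc n) x)" using g_ge[of "Suc n"] D0 by linarith
      then show "x \<in> good (Suc n)" using x by (auto simp: good_def le_Suc_eq)
    qed (auto simp: good_def less_imp_le simp del: funpow.simps)
    moreover have "closed {x. 0 \<le> Re ((f ^^ Suc n) x)}"
      by (intro closed_Collect_le cont continuous_on_const)
    ultimately show ?case using Suc by (simp add: closed_Int)
  qed
  \<comment> \<open>A point that is good for all \<open>n\<close> escapes and, being off
    \<open>E\<close>, lies on the countable orbit of \<open>a\<close>. A circle missing that orbit
    holds no such point, so by compactness some \<open>good n\<close> misses the circle.\<close>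
  have "\<exists>\<rho>'>\<rho>. \<rho>' \<notin> norm ` Orb"
  proof -
    have "countable (norm ` Orb)" unfolding Orb_def by simp
    moreover have "uncountable {\<rho><..<\<rho> + 1}" by (simp add: uncountable_open_interval)
    ultimately have "\<not> {\<rho><..<\<rho> + 1} \<subseteq> norm ` Orb" using countable_subset by blast
    then show ?thesis by auto
  qed
  then obtain \<rho>' where \<rho>': "\<rho>' > \<rho>" "\<rho>' \<notin> norm ` Orb" by blast
  have "\<exists>n. good n \<inter> sphere 0 \<rho>' = {}"
  proof (rule ccontr)
    assume "\<not> ?thesis"
    moreover have "compact (good n \<inter> sphere 0 \<rho>')" for n
      by (intro closed_Int_compact closed_good compact_sphere)
    moreover have "good n \<inter> sphere 0 \<rho>' \<subseteq> good m \<inter> sphere 0 \<rho>'" if "m \<le> n" for m n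
      using that by (auto simp: good_def)
    ultimately have "\<Inter> (range (\<lambda>n. good n \<inter> sphere 0 \<rho>')) \<noteq> {}"
      by (intro compact_nest) blast+
    then obtain x where "x \<in> (\<Inter>n. good n \<inter> sphere 0 \<rho>')" by blast
    then have x: "\<And>n. x \<in> good n" "norm x = \<rho>'" by auto
    have "real n \<le> Re ((f ^^ n) x)" for n
      using good_bound[OF x(1), of n n] g_ge[of n] D0 by simp
    then have "x \<in> I" unfolding escaping_iff
      by (intro filterlim_at_top_mono[OF filterlim_real_sequentially]) auto
    moreover have "x \<in> P" using x(1) by (auto simp: good_def)
    ultimately have "x \<in> Orb" using P(4) by (auto simp: E_def)
    then show False using x(2) \<rho>'(2) by auto
  qed
  then obtain n where n: "good n \<inter> sphere 0 \<rho>' = {}" by blast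
  \<comment> \<open>\<open>A\<close> is closed, and as \<open>good n\<close> misses the circle of
    radius \<open>\<rho>'\<close>, it is also open in \<open>P\<close>. It omits \<open>p0\<close>
    and is nonempty by \<open>far\<close>.\<close>
  define A where "A = good n \<inter> {x. \<rho>' \<le> norm x}"
  define U where "U = {x. \<rho>' < norm x} \<inter> (\<Inter>j\<le>n. {x. 0 < Re ((f ^^ j) x)})"
  have "closed A" unfolding A_def
    by (intro closed_Int closed_good closed_Collect_le continuous_intros)
  then have opA: "open (- A)" by blast
  have opU: "open U" unfolding U_def
    by (intro open_Int open_INT ballI finite_atMost open_Collect_less cont continuous_on_const
        continuous_on_norm_id)
  have AU: "P \<inter> U = A"
  proof
    show "A \<subseteq> P \<inter> U"
    proof
      fix x assume x: "x \<in> A"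
      then have "norm x \<noteq> \<rho>'" using n by (auto simp: A_def)
      then show "x \<in> P \<inter> U" using x by (auto simp: A_def U_def good_def)
    qed
  qed (use \<rho>'(1) in \<open>auto simp: A_def U_def good_def\<close>)
  have "U \<inter> P = {} \<or> - A \<inter> P = {}"
    by (rule connectedD[OF P(2) opU opA]) (use AU in auto)
  moreover have "p0 \<in> - A \<inter> P" using p0 \<rho>'(1) by (auto simp: A_def \<rho>_def)
  moreover have "U \<inter> P \<noteq> {}"
  proof -
    have "\<forall>j. \<exists>r. \<forall>x\<in>P. r \<le> norm x \<longrightarrow> 1 \<le> Re ((f ^^ j) x)" using far by blast
    then obtain r where r: "\<And>j x. x \<in> P \<Longrightarrow> r j \<le> norm x \<Longrightarrow> 1 \<le> Re ((f ^^ j) x)" by metis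
    define B where "B = Max (r ` {..n}) + \<bar>\<rho>'\<bar> + 1 + \<bar>Max (r ` {..n})\<bar>"
    obtain x where x: "x \<in> P" "B < norm x" using P(3) unfolding bounded_iff by (meson not_le)
    have "r j \<le> norm x" if "j \<le> n" for j
    proof -
      have "r j \<le> Max (r ` {..n})" using that by (intro Max_ge) auto
      then show ?thesis using x unfolding B_def by linarith
    qed
    then have "0 < Re ((f ^^ j) x)" if "j \<le> n" for j using r[OF x(1), of j] that by fastforce
    moreover have "\<rho>' < norm x" using x(2) unfolding B_def by linarith
    ultimately show ?thesis using x(1) unfolding U_def by blast
  qed
  ultimately show False by blast
qed

end

section \<open>Separations of the lifts\<close>

context access_ray
begin

section \<open>Orbit growth, and the curves and \<open>f\<close> far to the left and right\<close>

lemma norm_funpow_le: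
  assumes "norm y \<le> g 0" "\<And>n. g (Suc n) = exp (g n) + norm a"
  shows "norm ((f ^^ n) y) \<le> g n"
proof (induction n)
  case (Suc n)
  have "exp (Re ((f ^^ n) y)) \<le> exp (g n)"
    using complex_Re_le_cmod[of "(f ^^ n) y"] Suc by simp
  then show ?case using norm_f_le[of "(f ^^ n) y"] assms(2)[of n] by (simp del: exp_le_cancel_iff)
qed (use assms in simp)

lemma escaping_Re_bounded_below:
  assumes "z \<in> I"
  obtains M where "M \<ge> 0" "\<And>n. - M \<le> Re ((f ^^ n) z)"
proof -
  obtain N where N: "\<And>n. n \<ge> N \<Longrightarrow> 0 \<le> Re ((f ^^ n) z)"
    using assms by (auto simp: escaping_iff filterlim_at_top eventually_sequentially)
  define M where "M = (\<Sum>n<N. \<bar>Re ((f ^^ n) z)\<bar>)"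
  have "M \<ge> 0" by (simp add: M_def sum_nonneg)
  moreover have "- M \<le> Re ((f ^^ n) z)" for n
  proof (cases "n < N")
    case True
    then have "\<bar>Re ((f ^^ n) z)\<bar> \<le> M"
      unfolding M_def by (intro member_le_sum) auto
    then show ?thesis by linarith
  next
    case False
    then show ?thesis using N[of n] \<open>M \<ge> 0\<close> by linarith
  qed
  ultimately show thesis by (rule that)
qed

lemma curve_left: "\<exists>z\<in>curve k. Re z < - R"
proof -
  obtain s where s: "s > 0" "Re (lift s) \<le> - (R + 1)" using Re_lift_small[of 1 "R + 1"] by auto
  then show ?thesis by (intro bexI[OF _ curveI[OF s(1)]]) simp
qed

lemma curve_right: "\<exists>z\<in>curve k. R < Re z"
proof -
  obtain s where s: "s > 0" "R + 1 \<le> Re (lift s)" using Re_lift_large[of 0 "R + 1"] by auto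
  then show ?thesis by (intro bexI[OF _ curveI[OF s(1)]]) simp
qed

lemma unbounded_curve: "\<not> bounded (curve k)"
proof
  assume "bounded (curve k)"
  then obtain B where B: "\<And>z. z \<in> curve k \<Longrightarrow> norm z \<le> B" unfolding bounded_iff by blast
  obtain z where "z \<in> curve k" "B < Re z" using curve_right by blast
  then show False using B[of z] complex_Re_le_cmod[of z] by linarith
qed

lemma connected_left: "connected {z. Re z < - R}"
  by (intro convex_connected convex_halfspace_Re_lt)

lemma connected_right: "connected {z. R < Re z}"
  by (intro convex_connected convex_halfspace_Re_gt)

lemma a_in_closure_image:
  assumes "\<And>R. \<exists>x\<in>P. Re x < - R"
  shows "a \<in> closure (f ` P)"
  unfolding closure_approachable
proof (intro allI impI)
  fix e :: real assume e: "e > 0"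
  obtain x where x: "x \<in> P" "Re x < - (- ln e)" using assms by blast
  then have "exp (Re x) < exp (ln e)" by (simp del: exp_ln)
  then have "dist (f x) a < e" using e by (simp add: dist_norm norm_expmap_diff)
  then show "\<exists>y\<in>f ` P. dist y a < e" using x by blast
qed

lemma unbounded_image:
  assumes "\<And>R. \<exists>x\<in>P. R < Re x"
  shows "\<not> bounded (f ` P)"
proof
  assume "bounded (f ` P)"
  then obtain B where B: "\<And>x. x \<in> P \<Longrightarrow> norm (f x) \<le> B" unfolding bounded_iff by blast
  obtain x where x: "x \<in> P" "B + norm a < Re x" using assms by blast
  then have "B < norm (f x)"
    using norm_f_ge[of x] exp_ge_add_one_self[of "Re x"] by linarith
  then show False using B[OF x(1)] by simp
qed

definition ray :: "complex set" where "ray = \<gamma> ` {0<..}"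

lemma rayI [intro]: "t > 0 \<Longrightarrow> \<gamma> t \<in> ray"
  by (auto simp: ray_def)

lemma ray_subset_G: "ray \<subseteq> G"
  by (auto simp: ray_def)

lemma connected_ray: "connected ray"
  unfolding ray_def
  by (intro connected_continuous_image continuous_on_subset[OF continuous]) auto

lemma unbounded_ray: "\<not> bounded ray"
proof
  assume "bounded ray"
  then have "bounded (insert a ray)" by simp
  moreover have "G \<subseteq> insert a ray" using start by (force simp: ray_def less_eq_real_def)
  ultimately show False using unbounded_G bounded_subset by blast
qed

lemma a_in_closure_ray: "a \<in> closure ray"
proof -
  have "\<gamma> ` closure {0<..} \<subseteq> closure ray"
    by (rule image_closure_subset) (auto intro: continuous simp: ray_def closure_subset[THEN subsetD])
  then show ?thesis using start by auto
qed

end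

locale kneading = access_partition +
  fixes u :: "nat \<Rightarrow> int"
  assumes unique: "\<exists>!v. is_itinerary f S0 a v"
    and itin: "is_itinerary f S0 a u"
    and not_periodic: "\<not> periodic_seq u"
begin

text \<open>An orbit point on a lift lies in the closures of two strips, and altering
  \<open>u\<close> at that one position gives two itineraries.\<close>

lemma f_orbit_notin_G: "f ((f ^^ n) a) \<notin> G"
proof
  assume "f ((f ^^ n) a) \<in> G"
  then obtain j k where jk: "j \<noteq> k" "(f ^^ n) a \<in> closure (S j)" "(f ^^ n) a \<in> closure (S k)"
    by (rule closure_two_strips)
  have "is_itinerary f S0 a (u(n := j))" "is_itinerary f S0 a (u(n := k))"
    using itin jk by (auto simp: is_itinerary_def)
  then have "u(n := j) = u(n := k)" using unique by blast
  then show False using jk(1) by (metis fun_upd_same)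
qed

lemma orbit_in_S: "(f ^^ n) a \<in> S (u n)"
  using itin f_orbit_notin_G by (intro closure_S) (auto simp: is_itinerary_def)

text \<open>An orbit point of \<open>a\<close> on the ray is either \<open>a\<close>, excluded by
  injectivity of \<open>\<gamma>\<close>, or some \<open>f ((f ^^ m) a)\<close>, excluded by
  \<open>f_orbit_notin_G\<close>.\<close>

lemma ray_subset_E: "ray \<subseteq> E"
proof
  fix z assume "z \<in> ray"
  then obtain t where t: "t > 0" "z = \<gamma> t" by (auto simp: ray_def)
  have "z \<notin> Orb"
  proof
    assume "z \<in> Orb"
    then obtain n where n: "\<gamma> t = (f ^^ n) a" using t by (auto simp: Orb_def)
    show False
    proof (cases n)
      case 0
      then show False using n gamma_neq[OF t(1)] by simp
    next
      case (Suc m)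
      then have "f ((f ^^ m) a) = \<gamma> t" using n by simp
      then show False using f_orbit_notin_G[of m] t by auto
    qed
  qed
  then show "z \<in> E" using escapes t by (simp add: E_def)
qed

lemma curve_subset_E: "curve k \<subseteq> E"
proof
  fix z assume "z \<in> curve k"
  then have "f z \<in> ray" using f_lift by (auto simp: curve_def)
  then show "z \<in> E" using ray_subset_E E_backward by blast
qed

lemma disjoint_E_notin_G: "A \<inter> E = {} \<Longrightarrow> z \<in> A \<Longrightarrow> f z \<notin> G"
  using preimage_G_iff curve_subset_E by blast

text \<open>All lifts of the ray lie in \<open>E\<close>, so a connected set off \<open>E\<close>
  cannot pass from one strip to another.\<close>

lemma disjoint_E_strip:
  assumes "connected P" "P \<inter> E = {}"
  obtains m where "P \<subseteq> S m"
proof (cases "P = {}")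
  case False
  then show thesis using connected_in_strip[of P] disjoint_E_notin_G[OF assms(2)] assms(1) that by blast
qed (use that in auto)

text \<open>Continuity puts \<open>(f ^^ (n + i)) a\<close> into the closure of \<open>S k\<close>,
  while it also lies in an open strip of its own. Comparing two readings of the same strip will give
  shift invariance of \<open>u\<close>.\<close>

lemma closure_strip:
  assumes "(f ^^ i) a \<in> closure W" "(f ^^ n) ` W \<subseteq> S k"
  shows "k = u (n + i)"
proof -
  have "(f ^^ n) ` closure W \<subseteq> closure ((f ^^ n) ` W)"
    by (rule image_closure_subset) (auto intro: continuous_on_expmap_funpow closure_subset[THEN subsetD])
  then have "(f ^^ n) ((f ^^ i) a) \<in> closure (S k)"
    using assms closure_mono by blast
  then have "(f ^^ (n + i)) a \<in> closure (S k)" by (simp add: funpow_add)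
  then have "S (u (n + i)) \<inter> S k \<noteq> {}"
    using open_Int_closure_eq_empty[OF open_S, of "u (n + i)" "S k"] orbit_in_S by blast
  then show ?thesis using S_unique by blast
qed

lemma not_shift_invariant:
  assumes "\<And>n. u (n + Suc i) = u n"
  shows False
proof -
  have "1 \<le> Suc i \<and> (\<forall>j. u (j + Suc i) = u j)" using assms by simp
  then show False using not_periodic unfolding periodic_seq_def by blast
qed

text \<open>If \<open>a\<close> does not escape, then \<open>Z\<close> misses every escaping point, and an inverse branch of \<open>f\<close> off \<open>Z\<close>
  shows that \<open>f ^^ n\<close> maps the ray into a set meeting at most one of the curves; this transfers the
  orbit bound from the escaping point \<open>\<gamma> 1\<close> to \<open>Z\<close>.\<close>
lemma continuum_Im_bound:
  assumes Z: "closed Z" "connected Z" "\<not> bounded Z" "a \<in> Z" "Z \<inter> E = {}"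
    and strips: "\<And>n. (f ^^ n) ` Z \<subseteq> S (u n)"
  obtains y C where "\<And>n x. x \<in> Z \<Longrightarrow> 0 \<le> Re ((f ^^ n) x) \<Longrightarrow> \<bar>Im ((f ^^ n) x)\<bar> \<le> norm ((f ^^ n) y) + C"
proof (cases "a \<in> I")
  \<comment> \<open>An escaping \<open>a\<close> provides the comparison orbit: its real parts are
    bounded below and it shares every strip with \<open>Z\<close>.\<close>
  case True
  then obtain M where M: "M \<ge> 0" "\<And>n. - M \<le> Re ((f ^^ n) a)"
    using escaping_Re_bounded_below by blast
  obtain C where C: "\<And>k z. z \<in> S k \<Longrightarrow> - M \<le> Re z \<Longrightarrow> \<bar>Im z - 2 * pi * of_int k\<bar> \<le> C"
    using Im_S_bounded by metis
  have "\<bar>Im ((f ^^ n) x)\<bar> \<le> norm ((f ^^ n) a) + 2 * C" if x: "x \<in> Z" "0 \<le> Re ((f ^^ n) x)" for n x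
  proof -
    have "(f ^^ n) x \<in> S (u n)" using strips x by blast
    then have "\<bar>Im ((f ^^ n) x) - 2 * pi * of_int (u n)\<bar> \<le> C" using C x M(1) by force
    moreover have "\<bar>Im ((f ^^ n) a) - 2 * pi * of_int (u n)\<bar> \<le> C" using C orbit_in_S M by blast
    moreover have "\<bar>Im ((f ^^ n) a)\<bar> \<le> norm ((f ^^ n) a)" by (rule abs_Im_le_cmod)
    ultimately show ?thesis by linarith
  qed
  then show thesis by (rule that)
next
  case False
  have "Orb \<inter> I = {}" using False by (auto simp: Orb_def)
  then have EI: "E = I" by (auto simp: E_def)
  obtain M where M: "M \<ge> 0" "\<And>n. - M \<le> Re ((f ^^ n) (\<gamma> 1))"
    using escaping_Re_bounded_below[OF escapes[of 1]] by auto
  obtain C where C: "\<And>p. \<lbrakk>path p; - M \<le> Re (pathstart p); - M \<le> Re (pathfinish p);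
     C < \<bar>Im (pathfinish p) - Im (pathstart p)\<bar>\<rbrakk>
     \<Longrightarrow> \<exists>j k. j \<noteq> k \<and> path_image p \<inter> curve j \<noteq> {} \<and> path_image p \<inter> curve k \<noteq> {}"
    using path_meets_two_curves by metis
  have "\<bar>Im ((f ^^ n) x)\<bar> \<le> norm ((f ^^ n) (\<gamma> 1)) + C" if x: "x \<in> Z" "0 \<le> Re ((f ^^ n) x)" for n x
  proof (rule ccontr)
    assume "\<not> ?thesis"
    then have far: "C < \<bar>Im ((f ^^ n) (\<gamma> 1)) - Im ((f ^^ n) x)\<bar>"
      using abs_Im_le_cmod[of "(f ^^ n) (\<gamma> 1)"] by linarith
    have cont: "continuous_on {0..} (\<lambda>t. (f ^^ n) (\<gamma> t))"
      by (rule continuous_on_compose2[OF continuous_on_expmap_funpow continuous]) auto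
    obtain e where e: "e > 0" "ball ((f ^^ n) a) e \<subseteq> S (u n)"
      using open_S orbit_in_S open_contains_ball by metis
    obtain d where d: "d > 0" "\<And>t. t \<ge> 0 \<Longrightarrow> dist t 0 < d \<Longrightarrow> dist ((f ^^ n) (\<gamma> t)) ((f ^^ n) (\<gamma> 0)) < e"
      using cont[unfolded continuous_on_iff, rule_format, of 0 e] e by auto
    \<comment> \<open>\<open>\<gamma> s\<close> is so close to \<open>a\<close> that its iterate is
      still in \<open>S (u n)\<close>. A path inside this strip leads there from
      \<open>(f ^^ n) x\<close>, so only the rest, along the image of the ray, can meet
      curves.\<close>
    define s where "s = min 1 (d/2)"
    have s: "0 < s" "s \<le> 1" "s < d" using d(1) by (auto simp: s_def)
    have sS: "(f ^^ n) (\<gamma> s) \<in> S (u n)"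
      using d(2)[of s] s e(2) start by (auto simp: dist_commute subset_iff)
    define q where "q = (\<lambda>t. (f ^^ n) (\<gamma> t)) \<circ> linepath s 1"
    have seg: "closed_segment s 1 = {s..1}" using s by (simp add: closed_segment_eq_real_ivl)
    have q: "path q" unfolding q_def
      by (rule path_continuous_image)
        (use s in \<open>auto simp: seg intro!: continuous_on_subset[OF cont]\<close>)
    have q_im: "path_image q = (\<lambda>t. (f ^^ n) (\<gamma> t)) ` {s..1}"
      unfolding q_def by (simp add: path_image_compose seg)
    have q_ends: "pathstart q = (f ^^ n) (\<gamma> s)" "pathfinish q = (f ^^ n) (\<gamma> 1)"
      by (simp_all add: q_def pathstart_compose pathfinish_compose)
    have "path_connected (S (u n))"
      using open_S connected_S connected_open_path_connected by blast
    then obtain p where p: "path p" "path_image p \<subseteq> S (u n)" "pathstart p = (f ^^ n) x"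
        "pathfinish p = (f ^^ n) (\<gamma> s)"
      using sS strips x(1) unfolding path_connected_def by blast
    have "\<exists>j k. j \<noteq> k \<and> path_image (p +++ q) \<inter> curve j \<noteq> {} \<and> path_image (p +++ q) \<inter> curve k \<noteq> {}"
      by (rule C) (use p q q_ends far M x in \<open>auto intro: order_trans\<close>)
    then obtain j k where jk: "j \<noteq> k" "path_image (p +++ q) \<inter> curve j \<noteq> {}"
        "path_image (p +++ q) \<inter> curve k \<noteq> {}" by blast
    moreover have "path_image p \<inter> curve i = {}" for i using p(2) curve_not_S by blast
    moreover have "path_image (p +++ q) = path_image p \<union> path_image q"
      using p q_ends by (simp add: path_image_join)
    ultimately have meet: "curve j \<inter> path_image q \<noteq> {}" "path_image q \<inter> curve k \<noteq> {}" by blast+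
    \<comment> \<open>Two curves joined by a piece of the image of the ray, all inside the escaping
      set, which \<open>Z\<close> misses. An inverse branch off \<open>Z\<close> then recovers each
      point of \<open>J\<close> from its image, although both curves contain a preimage of
      \<open>\<gamma> 1\<close>.\<close>
    define J where "J = curve j \<union> path_image q \<union> curve k"
    have "connected J"
      unfolding J_def using meet connected_curve connected_path_image[OF q]
      by (intro connected_Un) auto
    have "path_image q \<subseteq> I" unfolding q_im using escapes s by auto
    then have "J \<subseteq> I" unfolding J_def using curve_subset_E EI by blast
    then have "f ` J \<subseteq> I" by auto
    then have "f ` J \<subseteq> - Z" using Z(5) EI by blast
    moreover have "connected (f ` J)"
      by (intro connected_continuous_image \<open>connected J\<close> continuous_intros)
    moreover have "- Z \<noteq> {}" using calculation(1) meet unfolding J_def by blast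
    ultimately obtain A where A: "A \<in> components (- Z)" "f ` J \<subseteq> A"
      using exists_component_superset by metis
    obtain l where l: "continuous_on A l" "\<And>w. w \<in> A \<Longrightarrow> exp (l w) = w - a"
      using log_off_continuum[OF Z(1-4) A(1)] by blast
    obtain c where c: "\<And>z. z \<in> J \<Longrightarrow> z = l (f z) + vshift c"
      using log_expmap_translate[OF l \<open>connected J\<close> A(2)] by blast
    have "lift 1 + vshift j \<in> J" "lift 1 + vshift k \<in> J" by (auto simp: J_def)
    from this[THEN c] have "lift 1 + vshift j = lift 1 + vshift k" by simp
    then show False using jk(1) by simp
  qed
  then show thesis by (rule that)
qed

text \<open>All points of \<open>Z\<close> share the strips of \<open>a\<close>. Nonperiodicity
  bounds every iterated image to the left, and then \<open>controlled_continuum_meets_E\<close>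
  applies.\<close>

lemma no_continuum_through_a:
  assumes Z: "closed Z" "connected Z" "\<not> bounded Z" "a \<in> Z" "Z \<inter> E = {}"
  shows False
proof -
  have strips: "(f ^^ n) ` Z \<subseteq> S (u n)" for n
  proof (rule connected_in_this_strip)
    show "connected ((f ^^ n) ` Z)"
      by (intro connected_continuous_image continuous_on_expmap_funpow Z(2))
    show "(f ^^ n) a \<in> (f ^^ n) ` Z" using Z(4) by blast
    show "f z \<notin> G" if "z \<in> (f ^^ n) ` Z" for z
      using disjoint_E_notin_G[OF funpow_image_disjoint_E[OF Z(5)] that] .
  qed (rule orbit_in_S)
  have left: "\<exists>R. \<forall>x\<in>Z. - R \<le> Re ((f ^^ n) x)" for n
  proof (rule ccontr)
    assume "\<not> ?thesis"
    then have "\<exists>x\<in>(f ^^ n) ` Z. Re x < - R" for R by (metis image_eqI not_le)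
    then have "a \<in> closure (f ` (f ^^ n) ` Z)" by (rule a_in_closure_image)
    then have a: "(f ^^ 0) a \<in> closure (f ` (f ^^ n) ` Z)" by simp
    have "u (m + Suc n) = u m" for m
    proof -
      have "(f ^^ m) ` f ` (f ^^ n) ` Z = (f ^^ m) ` (f ^^ Suc n) ` Z" by (simp add: image_comp)
      also have "\<dots> = (f ^^ (m + Suc n)) ` Z" by (simp only: funpow_add image_comp)
      finally have "(f ^^ m) ` f ` (f ^^ n) ` Z \<subseteq> S (u (m + Suc n))" using strips by metis
      from closure_strip[OF a this] show ?thesis by simp
    qed
    then show False by (rule not_shift_invariant)
  qed
  obtain y C where C: "\<And>n x. x \<in> Z \<Longrightarrow> 0 \<le> Re ((f ^^ n) x) \<Longrightarrow> \<bar>Im ((f ^^ n) x)\<bar> \<le> norm ((f ^^ n) y) + C"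
    using continuum_Im_bound[OF Z strips] by blast
  define g where "g n = ((\<lambda>x. exp x + norm a) ^^ n) (norm y)" for n
  have g: "0 \<le> g 0" "norm y \<le> g 0" "\<And>n. g (Suc n) = exp (g n) + norm a" by (auto simp: g_def)
  show False
  proof (rule controlled_continuum_meets_E[OF Z(1-3,5) _ left _ g(1,3)])
    show "\<exists>m. (f ^^ n) ` Z \<subseteq> S m" for n using strips by blast
    show "\<bar>Im ((f ^^ n) x)\<bar> \<le> g n + C" if "x \<in> Z" "0 \<le> Re ((f ^^ n) x)" for n x
      using C[OF that] norm_funpow_le[OF g(2,3), of n] by linarith
  qed
qed

text \<open>The left end of \<open>P\<close> is mapped towards \<open>a\<close> and the right end
  towards infinity, so adding \<open>a\<close> to the image gives a continuum excluded by
  \<open>no_continuum_through_a\<close>.\<close>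

lemma no_two_sided_continuum:
  assumes P: "closed P" "connected P" "P \<inter> E = {}"
    and left: "\<And>R. \<exists>x\<in>P. Re x < - R" and right: "\<And>R. \<exists>x\<in>P. R < Re x"
  shows False
proof (rule no_continuum_through_a)
  obtain m where "P \<subseteq> S m" using disjoint_E_strip P by blast
  then show "closed (insert a (f ` P))" using closed_insert_image P(1) by blast
  have "connected (f ` P)" by (intro connected_continuous_image P(2) continuous_intros)
  then show "connected (insert a (f ` P))"
  proof (rule connected_intermediate_closure)
    show "insert a (f ` P) \<subseteq> closure (f ` P)"
      using a_in_closure_image[OF left] closure_subset[of "f ` P"] by blast
  qed blast
  show "\<not> bounded (insert a (f ` P))" using unbounded_image[OF right] by simp
  show "insert a (f ` P) \<inter> E = {}" using image_disjoint_E[OF P(3)] a_notin_E by blast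
qed auto

lemma curves_not_separated:
  assumes UV: "open U" "open V" "U \<inter> V = {}" "E \<subseteq> U \<union> V" and j: "curve j \<inter> U \<noteq> {}"
  shows "curve k \<subseteq> U"
proof (rule ccontr)
  assume "\<not> curve k \<subseteq> U"
  then obtain z where z: "z \<in> curve k" "z \<in> V" using curve_subset_E UV(4) by blast
  obtain p where p: "p \<in> curve j" "p \<in> U" using j by blast
  obtain P where P': "closed P" "connected P" "P \<inter> (U \<union> V) = {}"
    and P: "\<not> connected_component (- P) p z"
    using separating_continuum[OF UV(1-3) p(2) z(2)] by blast
  have PE: "P \<inter> E = {}" using P'(3) UV(4) by blast
  \<comment> \<open>A connected set that meets all curves but not \<open>P\<close> would join
    \<open>p\<close> to \<open>z\<close> along \<open>curve j\<close> and \<open>curve k\<close>.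
    Left and right half planes meet all curves, so \<open>P\<close> reaches arbitrarily far both
    ways.\<close>
  have meet: "H \<inter> P \<noteq> {}" if H: "connected H" "\<And>i. H \<inter> curve i \<noteq> {}" for H
  proof
    assume "H \<inter> P = {}"
    moreover have "curve i \<inter> P = {}" for i using PE curve_subset_E by blast
    ultimately have "curve j \<union> H \<union> curve k \<subseteq> - P" by blast
    moreover have "connected (curve j \<union> H \<union> curve k)"
      using H connected_curve by (intro connected_Un) blast+
    ultimately have "connected_component (- P) p z"
      using p z by (intro connected_componentI[of "curve j \<union> H \<union> curve k"]) auto
    then show False using P by blast
  qed
  show False
  proof (rule no_two_sided_continuum[OF P'(1,2) PE])
    show "\<exists>x\<in>P. Re x < - R" for R
      using meet[OF connected_left, of R] curve_left by blast
    show "\<exists>x\<in>P. R < Re x" for R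
      using meet[OF connected_right, of R] curve_right by blast
  qed
qed

end

section \<open>Separating the ray from its lifts\<close>

context kneading
begin

text \<open>The requirement on \<open>f z\<close> says that no lift enters \<open>D\<close>. The
  index \<open>i\<close> is kept apart from the number of iterations because it restarts at
  \<open>0\<close> in one case of \<open>surrounds_step\<close>.\<close>

definition surrounds :: "complex set \<Rightarrow> complex set \<Rightarrow> nat \<Rightarrow> bool" where
  "surrounds P D i \<longleftrightarrow> closed P \<and> connected P \<and> P \<inter> E = {} \<and> D \<in> components (- P) \<and>
     (\<forall>z\<in>D. f z \<notin> G) \<and> (f ^^ i) ` ray \<subseteq> D \<and> \<not> bounded D"

lemma surroundsD:
  assumes "surrounds P D i"
  shows "closed P" "connected P" "P \<inter> E = {}" "D \<in> components (- P)"
    "\<And>z. z \<in> D \<Longrightarrow> f z \<notin> G" "(f ^^ i) ` ray \<subseteq> D" "\<not> bounded D"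
    "open D" "connected D" "D \<inter> P = {}" "closure D \<subseteq> D \<union> P" "(f ^^ i) a \<in> closure D"
proof -
  show *: "closed P" "connected P" "P \<inter> E = {}" "D \<in> components (- P)"
    "\<And>z. z \<in> D \<Longrightarrow> f z \<notin> G" "(f ^^ i) ` ray \<subseteq> D" "\<not> bounded D"
    using assms by (auto simp: surrounds_def)
  show "open D" using open_components[OF open_Compl[OF *(1)] *(4)] .
  show "connected D" using in_components_connected[OF *(4)] .
  show "D \<inter> P = {}" using in_components_subset[OF *(4)] by blast
  show "closure D \<subseteq> D \<union> P"
    using frontier_of_components_closed_complement[OF *(1,4)] closure_Un_frontier[of D] by blast
  have "(f ^^ i) ` closure ray \<subseteq> closure D"
    using *(6) closure_subset[of D]
    by (intro image_closure_subset continuous_on_expmap_funpow) auto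
  then show "(f ^^ i) a \<in> closure D" using a_in_closure_ray by blast
qed

lemma component_halfplane:
  assumes "D \<in> components (- P)" "\<And>z. z \<in> D \<Longrightarrow> f z \<notin> G"
    and "connected H" "H \<inter> curve 0 \<noteq> {}" "H \<inter> P = {}"
  shows "H \<inter> D = {}"
proof (rule ccontr)
  assume "H \<inter> D \<noteq> {}"
  then have "H \<subseteq> D"
    using components_maximal[OF assms(1,3)] assms(5) by blast
  then show False using assms(2,4) preimage_G_iff by blast
qed

text \<open>A boundary point of \<open>D\<close> lies in \<open>P\<close>, hence off the lifts, so
  the strips of \<open>D\<close> and \<open>P\<close> agree at it.\<close>

lemma surrounds_strip:
  assumes "surrounds P D i"
  obtains m where "P \<subseteq> S m" "D \<subseteq> S m"
proof -
  note sD = surroundsD[OF assms]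
  have "D \<noteq> {}" using sD(7) by auto
  then obtain m where m: "D \<subseteq> S m" using connected_in_strip[OF sD(9)] sD(5) by blast
  obtain m' where m': "P \<subseteq> S m'" using disjoint_E_strip sD by blast
  have "D \<noteq> UNIV" using sD(5) preimage_G_iff curve_left[of 0 0] by blast
  then have "frontier D \<noteq> {}" using \<open>D \<noteq> {}\<close> by (simp add: frontier_eq_empty)
  then obtain x where x: "x \<in> frontier D" by blast
  then have "x \<in> P" "x \<in> closure D"
    using frontier_of_components_closed_complement[OF sD(1,4)] by (auto simp: frontier_def)
  then have "x \<in> S m"
    using closure_S[of x m] closure_mono[OF m] disjoint_E_notin_G[OF sD(3)] by blast
  then have "m = m'" using S_unique m' \<open>x \<in> P\<close> by blast
  then show thesis using that m m' by blast
qed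

text \<open>The unbounded curves cannot enter a bounded domain whose boundary misses \<open>E\<close>.\<close>
lemma bounded_domain_strip:
  assumes B: "bounded B" "open B" "connected B" "B \<noteq> {}" "frontier B \<inter> E = {}"
  obtains k where "(f ^^ n) ` B \<subseteq> S k"
proof -
  have cc: "compact (closure B)" using B(1) by (simp add: compact_closure)
  let ?B = "(f ^^ n) ` B"
  have op: "open ?B" using B(2) by (rule open_expmap_funpow_image)
  have cb: "compact ((f ^^ n) ` closure B)"
    by (intro compact_continuous_image continuous_on_expmap_funpow cc)
  have sub: "?B \<subseteq> (f ^^ n) ` closure B" using closure_subset by blast
  then have "closure ?B \<subseteq> (f ^^ n) ` closure B"
    using cb by (intro closure_minimal compact_imp_closed)
  then have "frontier ?B \<subseteq> (f ^^ n) ` frontier B"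
    using op B(2) by (auto simp: frontier_def interior_open)
  then have fr: "frontier ?B \<inter> E = {}" using funpow_image_disjoint_E[OF B(5)] by blast
  have bd: "bounded ?B" using bounded_subset[OF compact_imp_bounded[OF cb] sub] .
  have "curve k \<inter> ?B = {}" for k
  proof (rule ccontr)
    assume "curve k \<inter> ?B \<noteq> {}"
    moreover have "curve k - ?B \<noteq> {}" using unbounded_curve bounded_subset[OF bd] by blast
    ultimately have "curve k \<inter> frontier ?B \<noteq> {}" by (rule connected_Int_frontier[OF connected_curve])
    then show False using fr curve_subset_E by blast
  qed
  then have "f z \<notin> G" if "z \<in> ?B" for z using that preimage_G_iff by blast
  moreover have "connected ?B"
    by (intro connected_continuous_image continuous_on_expmap_funpow B(3))
  moreover have "?B \<noteq> {}" using B(4) by simp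
  ultimately show thesis using connected_in_strip that by blast
qed

text \<open>If \<open>P\<close> were unbounded only to the left, then \<open>f ` D\<close> would be a bounded domain having both \<open>a\<close> and
  \<open>(f ^^ Suc i) a\<close> in its closure, which makes the kneading sequence periodic.\<close>
lemma surrounds_left_bounded:
  assumes "surrounds P D i"
  obtains R where "\<And>x. x \<in> P \<union> D \<Longrightarrow> - R \<le> Re x"
proof -
  note sD = surroundsD[OF assms]
  obtain m where m: "P \<subseteq> S m" "D \<subseteq> S m" using surrounds_strip[OF assms] by blast
  have "\<exists>R. \<forall>x\<in>P. - R \<le> Re x"
  proof (rule ccontr)
    assume "\<not> ?thesis"
    then have left: "\<And>R. \<exists>x\<in>P. Re x < - R" by (meson not_le)
    then have "\<not> (\<forall>R. \<exists>x\<in>P. R < Re x)" using no_two_sided_continuum[OF sD(1-3)] by blast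
    then obtain R where R: "\<And>x. x \<in> P \<Longrightarrow> Re x \<le> R" by (auto simp: not_less)
    have "{z. R < Re z} \<inter> D = {}"
      by (rule component_halfplane[OF sD(4,5) connected_right])
        (use curve_right[of 0 R] R in \<open>auto simp: not_less[symmetric]\<close>)
    then have RD: "\<And>x. x \<in> D \<Longrightarrow> Re x \<le> R" by (auto simp: not_less[symmetric])
    \<comment> \<open>\<open>D\<close> is unbounded, inside a strip and bounded to the right, so it
      must extend to the left.\<close>
    have leftD: "\<exists>x\<in>D. Re x < - R'" for R'
    proof (rule ccontr)
      assume "\<not> ?thesis"
      then have "\<And>x. x \<in> D \<Longrightarrow> - R' \<le> Re x" by (meson not_le)
      then obtain \<rho> where "\<And>w. w \<in> D \<Longrightarrow> \<rho> \<le> norm w \<Longrightarrow> R + 1 \<le> Re w"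
        using Re_large_if_norm_large[OF m(2)] by blast
      then have "norm w \<le> \<rho>" if "w \<in> D" for w using RD that by (smt (verit))
      then show False using sD(7) bounded_iff by blast
    qed
    define B where "B = f ` D"
    have clD: "closure D \<subseteq> S m" using sD(11) m by blast
    have "closed (insert a (f ` closure D))" by (rule closed_insert_image[OF closed_closure clD])
    moreover have "B \<subseteq> insert a (f ` closure D)" using closure_subset by (auto simp: B_def)
    ultimately have "closure B \<subseteq> insert a (f ` closure D)" by (rule closure_minimal[rotated])
    moreover have opB: "open B" unfolding B_def by (rule open_expmap_image[OF sD(8)])
    ultimately have "frontier B \<subseteq> insert a (f ` P)"
      using sD(11) by (auto simp: frontier_def interior_open B_def)
    then have frB: "frontier B \<inter> E = {}" using image_disjoint_E[OF sD(3)] a_notin_E by blast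
    have "norm w \<le> exp R + norm a" if "w \<in> B" for w
    proof -
      obtain x where x: "x \<in> D" "w = f x" using \<open>w \<in> B\<close> by (auto simp: B_def)
      then have "exp (Re x) \<le> exp R" using RD by simp
      then show ?thesis using norm_f_le[of x] unfolding x(2) by linarith
    qed
    then have bdB: "bounded B" unfolding bounded_iff by blast
    have conB: "connected B" unfolding B_def by (intro connected_continuous_image sD(9) continuous_intros)
    have neB: "B \<noteq> {}" using sD(7) by (auto simp: B_def)
    have a1: "(f ^^ 0) a \<in> closure B" using a_in_closure_image[OF leftD] by (simp add: B_def)
    have "f ` closure D \<subseteq> closure B"
      unfolding B_def by (rule image_closure_subset) (auto intro: continuous_intros closure_subset[THEN subsetD])
    then have a2: "(f ^^ Suc i) a \<in> closure B" using sD(12) by auto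
    have "u (n + Suc i) = u n" for n
    proof -
      obtain k where k: "(f ^^ n) ` B \<subseteq> S k"
        using bounded_domain_strip[OF bdB opB conB neB frB] by blast
      show ?thesis using closure_strip[OF a1 k] closure_strip[OF a2 k] by simp
    qed
    then show False by (rule not_shift_invariant)
  qed
  then obtain R where R: "\<And>x. x \<in> P \<Longrightarrow> - R \<le> Re x" by blast
  \<comment> \<open>The half plane left of \<open>P\<close> contains points of a lift, so it cannot
    be part of \<open>D\<close>.\<close>
  have "{z. Re z < - R} \<inter> D = {}"
    by (rule component_halfplane[OF sD(4,5) connected_left])
      (use curve_left[of 0 R] R in \<open>auto simp: not_less[symmetric]\<close>)
  then have "\<And>x. x \<in> D \<Longrightarrow> - R \<le> Re x" by (auto simp: not_less[symmetric])
  then show thesis using that[of R] R by blast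
qed

text \<open>\<open>D\<close> is unbounded in a strip and bounded to the left, so it extends to the
  right. If \<open>P\<close> did not, a right half plane would lie in \<open>D\<close> and bring a
  lift with it.\<close>

lemma surrounds_right_unbounded:
  assumes "surrounds P D i"
  shows "\<exists>x\<in>P. R < Re x" "\<exists>x\<in>D. R < Re x"
proof -
  note sD = surroundsD[OF assms]
  obtain m where m: "P \<subseteq> S m" "D \<subseteq> S m" using surrounds_strip[OF assms] by blast
  obtain R' where R': "\<And>x. x \<in> P \<union> D \<Longrightarrow> - R' \<le> Re x"
    using surrounds_left_bounded[OF assms] by blast
  have D: "\<exists>x\<in>D. r < Re x" for r
  proof -
    obtain \<rho> where \<rho>: "\<And>w. w \<in> D \<Longrightarrow> \<rho> \<le> norm w \<Longrightarrow> r + 1 \<le> Re w"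
      using Re_large_if_norm_large[OF m(2), of R'] R' by blast
    obtain w where "w \<in> D" "\<rho> < norm w" using sD(7) unfolding bounded_iff by (meson not_le)
    then show ?thesis using \<rho>[of w] by (intro bexI[of _ w]) auto
  qed
  then show "\<exists>x\<in>D. R < Re x" .
  show "\<exists>x\<in>P. R < Re x"
  proof (rule ccontr)
    assume "\<not> ?thesis"
    then have "{z. R < Re z} \<inter> P = {}" by auto
    then have "{z. R < Re z} \<inter> D = {}"
      using curve_right[of 0 R]
      by (intro component_halfplane[OF sD(4,5) connected_right]) auto
    then show False using D[of R] by auto
  qed
qed

text \<open>The frontier of \<open>D\<close> lies in \<open>P\<close>, off \<open>E\<close>, so
  \<open>D\<close> and its exterior cover \<open>E\<close> and \<open>curves_not_separated\<close>
  applies.\<close>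

lemma component_disjoint_curves:
  assumes P: "closed P" "P \<inter> E = {}" and D: "D \<in> components (- P)" and z: "z \<in> D \<inter> curve j"
  shows "curve k \<subseteq> D"
proof (rule curves_not_separated[of D "- closure D"])
  show "open D" using open_components[OF open_Compl[OF P(1)] D] .
  show "E \<subseteq> D \<union> - closure D"
    using frontier_of_components_closed_complement[OF P(1) D] P(2) closure_Un_frontier[of D] by blast
  show "D \<inter> - closure D = {}" using closure_subset by blast
  show "curve j \<inter> D \<noteq> {}" using z by blast
qed auto

text \<open>As \<open>f\<close> is injective on the strip, the image of \<open>D\<close> is a
  complementary domain of the image of \<open>P\<close>. If no lift enters it, it continues with
  \<open>Suc i\<close>. Otherwise it contains all lifts; as it misses the ray, the domain around the
  ray is a different one, free of lifts, and the index restarts at \<open>0\<close>.\<close>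

lemma surrounds_step:
  assumes "surrounds P D i"
  obtains D' i' where "i' \<le> Suc i" "surrounds (f ` P) D' i'"
proof -
  note sD = surroundsD[OF assms]
  obtain m where m: "P \<subseteq> S m" "D \<subseteq> S m" using surrounds_strip[OF assms] by blast
  obtain R where R: "\<And>x. x \<in> P \<union> D \<Longrightarrow> - R \<le> Re x"
    using surrounds_left_bounded[OF assms] by blast
  have clP: "closed (f ` P)" by (rule closed_image[OF sD(1) m(1)]) (use R in blast)
  have conP: "connected (f ` P)" by (intro connected_continuous_image sD(2) continuous_intros)
  have PE: "f ` P \<inter> E = {}" by (rule image_disjoint_E[OF sD(3)])
  have opD: "open (f ` D)" by (rule open_expmap_image[OF sD(8)])
  have conD: "connected (f ` D)" by (intro connected_continuous_image sD(9) continuous_intros)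
  have disj: "f ` D \<inter> f ` P = {}" using inj_on_image_Int[OF inj_on_S m(2,1)] sD(10) by simp
  have neD: "f ` D \<noteq> {}" using sD(7) by auto
  have "closed (f ` closure D)"
    by (rule closed_image[of _ m R]) (use sD(11) m R in blast)+
  then have "closure (f ` D) \<subseteq> f ` closure D"
    by (intro closure_minimal image_mono closure_subset)
  then have "closure (f ` D) \<subseteq> f ` D \<union> f ` P" using sD(11) by blast
  then have fr: "frontier (f ` D) \<subseteq> f ` P"
    using opD by (auto simp: frontier_def interior_open)
  have compD: "f ` D \<in> components (- f ` P)"
  proof -
    obtain C where C: "C \<in> components (- f ` P)" "f ` D \<subseteq> C"
      using exists_component_superset[of "f ` D" "- f ` P"] conD disj neD by blast
    have "C \<subseteq> f ` D"
    proof (rule ccontr)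
      assume "\<not> C \<subseteq> f ` D"
      then have "C \<inter> frontier (f ` D) \<noteq> {}"
        using connected_Int_frontier[OF in_components_connected[OF C(1)], of "f ` D"] C(2) neD by blast
      then show False using fr in_components_subset[OF C(1)] by blast
    qed
    then show ?thesis using C by (metis subset_antisym)
  qed
  show thesis
  proof (cases "\<forall>z\<in>f ` D. f z \<notin> G")
    case True
    have "(f ^^ Suc i) ` ray \<subseteq> f ` D"
      using sD(6) unfolding funpow_image_Suc by (rule image_mono)
    moreover have "\<not> bounded (f ` D)"
      by (rule unbounded_image) (rule surrounds_right_unbounded(2)[OF assms])
    ultimately have "surrounds (f ` P) (f ` D) (Suc i)"
      unfolding surrounds_def using clP conP PE compD True by blast
    then show thesis using that by blast
  next
    case False
    then obtain z j where z: "z \<in> f ` D \<inter> curve j" using preimage_G_iff by blast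
    have all: "curve k \<subseteq> f ` D" for k by (rule component_disjoint_curves[OF clP PE compD z])
    have "ray \<subseteq> - f ` P" using PE ray_subset_E by blast
    then obtain D' where D': "D' \<in> components (- f ` P)" "ray \<subseteq> D'"
      using exists_component_superset[of ray "- f ` P"] connected_ray by (metis rayI equals0D zero_less_one subset_empty)
    have "f ` D \<inter> ray = {}" using sD(5) ray_subset_G by blast
    then have "D' \<noteq> f ` D" using D'(2) rayI[of 1] by auto
    then have D'D: "D' \<inter> f ` D = {}" using components_nonoverlap[OF D'(1) compD] by blast
    have "f w \<notin> G" if w: "w \<in> D'" for w
    proof
      assume "f w \<in> G"
      then obtain k where "w \<in> curve k" using preimage_G_iff by blast
      then have "w \<in> f ` D" using all by (rule subsetD[rotated])
      then show False using w D'D unfolding disjoint_iff by simp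
    qed
    moreover have "\<not> bounded D'" using unbounded_ray bounded_subset D'(2) by blast
    ultimately have "surrounds (f ` P) D' 0"
      unfolding surrounds_def using clP conP PE D' by auto
    then show thesis using that by blast
  qed
qed

text \<open>At time \<open>n\<close> the index \<open>i\<close> is at most \<open>n\<close>. The
  point \<open>(f ^^ i) (\<gamma> 1)\<close> shares a strip with the \<open>n\<close>-th image of
  \<open>P\<close>, and its modulus is at most \<open>g i \<le> g n\<close>, which controls the
  imaginary parts there.\<close>

lemma not_surrounds: "\<not> surrounds P D 0"
proof
  assume s0: "surrounds P D 0"
  note sD = surroundsD[OF s0]
  have iter: "\<exists>D' i. i \<le> n \<and> surrounds ((f ^^ n) ` P) D' i" for n
  proof (induction n)
    case 0
    then show ?case using s0 by auto
  next
    case (Suc n)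
    then obtain D' i where "i \<le> n" "surrounds ((f ^^ n) ` P) D' i" by blast
    moreover from this obtain D'' i' where "i' \<le> Suc i" "surrounds (f ` (f ^^ n) ` P) D'' i'"
      using surrounds_step by blast
    ultimately have "i' \<le> Suc n" "surrounds ((f ^^ Suc n) ` P) D'' i'"
      unfolding funpow_image_Suc by auto
    then show ?case by blast
  qed
  define g where "g n = ((\<lambda>x. exp x + norm a) ^^ n) (norm (\<gamma> 1))" for n
  have g: "0 \<le> g 0" "norm (\<gamma> 1) \<le> g 0" "\<And>n. g (Suc n) = exp (g n) + norm a" by (auto simp: g_def)
  have g_mono: "g i \<le> g n" if "i \<le> n" for i n
  proof (rule lift_Suc_mono_le[OF _ that])
    show "g n \<le> g (Suc n)" for n
      using exp_ge_add_one_self[of "g n"] norm_ge_zero[of a] g(3)[of n] by linarith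
  qed
  obtain M where M: "M \<ge> 0" "\<And>n. - M \<le> Re ((f ^^ n) (\<gamma> 1))"
    using escaping_Re_bounded_below[OF escapes[of 1]] by auto
  obtain C where C: "\<And>k z. z \<in> S k \<Longrightarrow> - M \<le> Re z \<Longrightarrow> \<bar>Im z - 2 * pi * of_int k\<bar> \<le> C"
    using Im_S_bounded by metis
  have "\<not> bounded P"
  proof
    assume "bounded P"
    then obtain B where B: "\<And>x. x \<in> P \<Longrightarrow> norm x \<le> B" unfolding bounded_iff by blast
    obtain x where "x \<in> P" "B < Re x" using surrounds_right_unbounded(1)[OF s0] by blast
    then show False using B[of x] complex_Re_le_cmod[of x] by linarith
  qed
  then show False
  proof (rule controlled_continuum_meets_E[OF sD(1,2) _ sD(3) _ _ _ g(1,3)])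
    fix n
    obtain D' i where D': "i \<le> n" "surrounds ((f ^^ n) ` P) D' i" using iter by blast
    obtain m where m: "(f ^^ n) ` P \<subseteq> S m" "D' \<subseteq> S m" using surrounds_strip[OF D'(2)] by blast
    then show "\<exists>m. (f ^^ n) ` P \<subseteq> S m" by blast
    show "\<exists>R. \<forall>x\<in>P. - R \<le> Re ((f ^^ n) x)"
      using surrounds_left_bounded[OF D'(2)] by (metis UnI1 image_eqI)
    show "\<bar>Im ((f ^^ n) x)\<bar> \<le> g n + 2 * C" if x: "x \<in> P" "0 \<le> Re ((f ^^ n) x)" for x
    proof -
      have "(f ^^ n) x \<in> S m" using m x by blast
      then have "\<bar>Im ((f ^^ n) x) - 2 * pi * of_int m\<bar> \<le> C" using C x M(1) by force
      moreover have "(f ^^ i) (\<gamma> 1) \<in> S m"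
        using surroundsD(6)[OF D'(2)] m(2) rayI[of 1] by auto
      then have "\<bar>Im ((f ^^ i) (\<gamma> 1)) - 2 * pi * of_int m\<bar> \<le> C" using C M(2) by blast
      moreover have "norm ((f ^^ i) (\<gamma> 1)) \<le> g i" by (rule norm_funpow_le[OF g(2,3)])
      moreover have "g i \<le> g n" by (rule g_mono[OF D'(1)])
      ultimately show ?thesis using abs_Im_le_cmod[of "(f ^^ i) (\<gamma> 1)"] by linarith
    qed
  qed
qed

text \<open>The domain of \<open>- P\<close> around the ray is free of lifts: one lift in it would
  bring in all of them, and with \<open>curve k\<close> the point \<open>z\<close>, which
  \<open>P\<close> separates from \<open>p\<close>. This is the situation excluded by
  \<open>not_surrounds\<close>.\<close>

lemma ray_not_separated_from_curves:
  assumes UV: "open U" "open V" "U \<inter> V = {}" "E \<subseteq> U \<union> V" and ray: "ray \<inter> V \<noteq> {}"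
  shows "curve k \<subseteq> V"
proof (rule ccontr)
  assume "\<not> curve k \<subseteq> V"
  then obtain z where z: "z \<in> curve k" "z \<in> U" using curve_subset_E UV(4) by blast
  obtain p where p: "p \<in> ray" "p \<in> V" using ray by blast
  obtain P where P': "closed P" "connected P" "P \<inter> (V \<union> U) = {}"
    and P: "\<not> connected_component (- P) p z"
    using separating_continuum[OF UV(2,1) _ p(2) z(2)] UV(3) by blast
  have PE: "P \<inter> E = {}" using P'(3) UV(4) by blast
  have "ray \<subseteq> - P" using PE ray_subset_E by blast
  then obtain D where D: "D \<in> components (- P)" "ray \<subseteq> D"
    using exists_component_superset[of ray "- P"] connected_ray p(1) by blast
  have "f w \<notin> G" if w: "w \<in> D" for w
  proof
    assume "f w \<in> G"
    then obtain j where "w \<in> D \<inter> curve j" using preimage_G_iff w by blast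
    then have "curve k \<subseteq> D" by (rule component_disjoint_curves[OF P'(1) PE D(1)])
    then have "connected_component (- P) p z"
      using z p D in_components_connected[OF D(1)] in_components_subset[OF D(1)]
      by (intro connected_componentI[of D]) auto
    then show False using P by blast
  qed
  moreover have "\<not> bounded D" using unbounded_ray bounded_subset D(2) by blast
  ultimately have "surrounds P D 0"
    unfolding surrounds_def using P' PE D by auto
  then show False using not_surrounds by blast
qed

text \<open>Separations of \<open>E\<close> are pushed forward along \<open>f\<close> on a single strip.\<close>
lemma ray_preimages_not_separated:
  assumes "open U" "open V" "U \<inter> V = {}" "E \<subseteq> U \<union> V" "ray \<subseteq> U" "(f ^^ n) z \<in> ray"
  shows "z \<in> U"
  using assms
proof (induction n arbitrary: U V z)
  case (Suc n)
  have z: "(f ^^ n) (f z) \<in> ray" using Suc.prems(6) by (simp add: funpow_swap1)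
  have curves: "curve k \<subseteq> U" for k
    by (rule ray_not_separated_from_curves[of V U]) (use Suc.prems(1-5) rayI[of 1] in auto)
  show ?case
  proof (cases "f z \<in> G")
    case True
    then show ?thesis using curves preimage_G_iff by blast
  next
    case False
    then obtain k where k: "z \<in> S k" using S_cover by blast
    \<comment> \<open>By \<open>key\<close> this image is relatively closed in \<open>E\<close>, so
      \<open>V'\<close> and its exterior again separate \<open>E\<close>. The ray is on the exterior
      side because strips are mapped off \<open>G\<close>.\<close>
    define V' where "V' = f ` (S k \<inter> V)"
    have opV': "open V'" unfolding V'_def using open_S Suc.prems(2) by (intro open_expmap_image) auto
    have key: "w \<in> V'" if w: "w \<in> E" "w \<in> closure V'" for w
    proof -
      obtain x where x: "\<And>i. x i \<in> V'" "x \<longlonglongrightarrow> w"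
        using w(2) unfolding closure_sequential by blast
      then have "\<forall>i. \<exists>y. y \<in> S k \<inter> V \<and> x i = f y" by (auto simp: V'_def)
      then obtain y where y: "\<And>i. y i \<in> S k \<inter> V" "\<And>i. x i = f (y i)" by metis
      have "(\<lambda>i. f (y i)) \<longlonglongrightarrow> w" using x(2) by (simp flip: y(2))
      moreover have "w \<noteq> a" using w(1) a_notin_E by blast
      ultimately obtain r v where v: "strict_mono (r :: nat \<Rightarrow> nat)" "(y \<circ> r) \<longlonglongrightarrow> v" "f v = w"
        using S_preimage_sequence[of y k w] y(1) by blast
      have "(y \<circ> r) i \<in> S k \<inter> V" for i using y(1) by simp
      then have vc: "v \<in> closure (S k \<inter> V)" unfolding closure_sequential using v(2) by blast
      \<comment> \<open>All curves lie in \<open>U\<close>, so a limit outside \<open>U\<close> is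
        off the curves and therefore still in \<open>S k\<close>.\<close>
      then have "v \<notin> U"
        using open_Int_closure_eq_empty[OF Suc.prems(1), of "S k \<inter> V"] Suc.prems(3) by blast
      moreover have "v \<in> E" using E_backward v(3) w(1) by blast
      ultimately have "v \<in> V" using Suc.prems(4) by blast
      moreover have "f v \<notin> G" using \<open>v \<notin> U\<close> curves preimage_G_iff by blast
      then have "v \<in> S k" using closure_S vc closure_mono[of "S k \<inter> V" "S k"] by blast
      ultimately show ?thesis using v(3) by (auto simp: V'_def)
    qed
    have "V' \<inter> G = {}" by (auto simp: V'_def mem_S_iff)
    then have "ray \<inter> V' = {}" using ray_subset_G by blast
    then have "ray \<subseteq> - closure V'" using key ray_subset_E by blast
    then have "f z \<in> - closure V'"
      by (intro Suc.IH[of "- closure V'" V'] z opV') (use key closure_subset in auto)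
    then have "f z \<notin> V'" using closure_subset by blast
    then have "z \<notin> V" using k by (auto simp: V'_def)
    moreover have "z \<in> E" using E_backward_funpow[of "Suc n" z] Suc.prems(6) ray_subset_E by blast
    ultimately show ?thesis using Suc.prems(4) by blast
  qed
qed auto

text \<open>Density puts a ray preimage from \<open>E\<close> on each side of a separation, whereas
  the ray lies on one side and \<open>ray_preimages_not_separated\<close> keeps all its preimages
  there.\<close>

lemma connected_escaping_set: "connected I"
proof (rule connectedI)
  fix A B assume AB: "open A" "open B" "A \<inter> I \<noteq> {}" "B \<inter> I \<noteq> {}" "A \<inter> B \<inter> I = {}" "I \<subseteq> A \<union> B"
  \<comment> \<open>\<open>A\<close> and \<open>B\<close> are disjoint only within the escaping set.
    Comparing distances to their traces on \<open>E\<close> gives open sets disjoint in the whole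
    plane, as \<open>separating_continuum\<close> requires.\<close>
  define U where "U = {x. infdist x (A \<inter> E) < infdist x (B \<inter> E)}"
  define V where "V = {x. infdist x (B \<inter> E) < infdist x (A \<inter> E)}"
  have UV: "open U" "open V" "U \<inter> V = {}"
    unfolding U_def V_def by (auto intro!: open_Collect_less continuous_intros)
  have meet: "\<exists>w n. w \<in> W \<and> w \<in> E \<and> (f ^^ n) w \<in> ray" if W: "open W" "W \<inter> I \<noteq> {}" for W
  proof -
    obtain z where "z \<in> W" "z \<in> I" using W(2) by blast
    then obtain w n t where "w \<in> W" "t > 0" "(f ^^ n) w = \<gamma> t"
      using ray_preimages_dense[OF _ W(1)] by metis
    moreover from this have "(f ^^ n) w \<in> ray" by auto
    moreover from this have "w \<in> E" using E_backward_funpow ray_subset_E by blast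
    ultimately show ?thesis by blast
  qed
  obtain p m where p: "p \<in> A" "p \<in> E" "(f ^^ m) p \<in> ray" using meet AB by metis
  obtain q n where q: "q \<in> B" "q \<in> E" "(f ^^ n) q \<in> ray" using meet AB by metis
  have EI: "E \<subseteq> I" by (auto simp: E_def)
  have pos: "0 < infdist x (C \<inter> E)" if "open D" "x \<in> D" "D \<inter> C \<inter> I = {}" "C \<inter> E \<noteq> {}" for x C D
  proof -
    have "x \<notin> closure (C \<inter> E)"
      using open_Int_closure_eq_empty[OF that(1), of "C \<inter> E"] that EI by blast
    then show ?thesis
      using that(4) infdist_nonneg[of x "C \<inter> E"] in_closure_iff_infdist_zero[of "C \<inter> E" x] by fastforce
  qed
  have AU: "A \<inter> E \<subseteq> U"
  proof
    fix x assume x: "x \<in> A \<inter> E"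
    then show "x \<in> U" using pos[of A x B] AB q by (auto simp: U_def)
  qed
  have BV: "B \<inter> E \<subseteq> V"
  proof
    fix x assume x: "x \<in> B \<inter> E"
    then show "x \<in> V" using pos[of B x A] AB p by (auto simp: V_def Int_commute)
  qed
  have EUV: "E \<subseteq> U \<union> V" using AU BV EI AB(6) by blast
  have "ray \<subseteq> U \<or> ray \<subseteq> V"
    using connectedD[OF connected_ray UV(1,2)] UV(3) EUV ray_subset_E by blast
  then show False
  proof
    assume "ray \<subseteq> U"
    then have "q \<in> U" using ray_preimages_not_separated[OF UV EUV _ q(3)] by blast
    then show False using BV q UV(3) by blast
  next
    assume "ray \<subseteq> V"
    then have "p \<in> V" using ray_preimages_not_separated[of V U m p] UV EUV p by blast
    then show False using AU p UV(3) by blast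
  qed
qed

end

theorem theorem4p3:
  fixes a :: complex and \<gamma> :: "real \<Rightarrow> complex" and S0 :: "complex set" and u :: "nat \<Rightarrow> int"
  assumes "access_curve (expmap a) a \<gamma>"
    and "S0 \<in> components (- {z. expmap a z \<in> \<gamma> ` {0..}})"
    and "\<exists>!v. is_itinerary (expmap a) S0 a v"
    and "is_itinerary (expmap a) S0 a u"
    and "\<not> periodic_seq u"
  shows "connected (escaping_set (expmap a))"
proof -
  interpret kneading a \<gamma> S0 u
    using assms by unfold_locales (auto simp: access_curve_def)
  show ?thesis by (rule connected_escaping_set)
qed

end
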